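(* Let $d\ge1$. For every $x_1,\dots,x_n\in\mathbb{T}_{\pm}^d$ (with $n\ge1$) we have $$\mathrm{conv}_{TC}(x_1,\dots,x_n)=\bigcap\bigl\{\mathrm{sval}\bigl(\mathrm{conv}(\mathbf{x}_1,\dots,\mathbf{x}_n)\bigr):\ \mathbf{x}_i\in\mathrm{sval}^{-1}(x_i)\ \text{for all }i\bigr\}=\bigcap_{J\subseteq\{1,\dots,d\}}\mathrm{sval}\Bigl(\mathrm{conv}\bigl(\mathsf{li}_J(x_1),\dots,\mathsf{li}_J(x_n)\bigr)\Bigr),$$ where $\mathrm{conv}$ denotes the usual convex hull in $\mathbb{K}^d$.
   Context: Signed tropical numbers. Let $\mathbb{O}=-\infty$ be the tropical zero. $\mathbb{T}_{>\mathbb{O}}=\mathbb{R}$ (positive numbers), $\mathbb{T}_{<\mathbb{O}}=\{\ominus r: r\in\mathbb{R}\}$ (negative numbers), $\mathbb{T}_{\pm}=\mathbb{T}_{>\mathbb{O}}\cup\mathbb{T}_{<\mathbb{O}}\cup\{\mathbb{O}\}$, balanced numbers $\mathbb{T}_{\bullet}=\{\bullet r: r\in\mathbb{R}\}\cup\{\mathbb{O}\}$, symmetrized semiring $\mathbb{S}=\mathbb{T}_{\pm}\cup\mathbb{T}_{\bullet}$. The norm is $|r|=|\ominus r|=|\bullet r|=r$ and $|\mathbb{O}|=\mathbb{O}$; the sign $\mathrm{tsgn}$ takes values in $\{\oplus,\ominus,\bullet,\mathbb{O}\}$. Addition on $\mathbb{S}$: $x\oplus y$ equals $x$ if $|x|>|y|$,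 $y$ if $|y|>|x|$, $x$ if $|x|=|y|$ and $\mathrm{tsgn}(x)=\mathrm{tsgn}(y)$, and $\bullet|x|$ if $|x|=|y|$ and the signs differ. Multiplication: $x\odot y$ has norm $|x|+|y|$ and sign the product of signs (with $\oplus,\ominus,\bullet$ multiplying like $1,-1,0$); $\mathbb{O}$ is absorbing. The multiplicative unit is the real number $0$. TC-convexity. For $a=(a_0,\dots,a_d)\in\mathbb{T}_{\pm}^{d+1}$ with $(a_1,\dots,a_d)\ne(\mathbb{O},\dots,\mathbb{O})$, the closed halfspace is $\overline{\mathcal{H}}^+(a)=\{x\in\mathbb{T}_{\pm}^d: a_0\oplus a_1\odot x_1\oplus\dots\oplus a_d\odot x_d\in\mathbb{T}_{>\mathbb{O}}\cup\mathbb{T}_{\bullet}\}$. For two points, $\mathrm{conv}_{TC}(x,y)$ is the intersection of all closed halfspaces containing both. A set $S$ is TC-convex if $\mathrm{conv}_{TC}(x,y)\subseteq S$ for all $x,y\in S$. $\mathrm{conv}_{TC}(M)$ is the intersection of all TC-convex sets containing $M$. Puiseux series and lifts. $\mathbb{K}$ is the field of generalized real Puiseux series: formal series $\gamma=\sum_i c_it^{\alpha_i}$ with $\alpha_i\in\mathbb{R}$, nonzero $c_i\in\mathbb{R}$, $\alpha_0>\alpha_1>\cdots$, where $(\alpha_i)$ is finite (possibly empty, giving $0$) or unbounded. $\gamma\neq0$ is positive iff $c_0>0$; this makes $\mathbb{K}$ an ordered (real closed) field. The signed valuation $\mathrm{sval}:\mathbb{K}\to\mathbb{T}_{\pm}$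 sends $\gamma$ to $\alpha_0$ if $\gamma>0$, to $\mathbb{O}$ if $\gamma=0$, to $\ominus\alpha_0$ if $\gamma<0$; it is extended componentwise to vectors and to sets by taking images. For $x\in\mathbb{T}_{\pm}^d$ and $J\subseteq\{1,\dots,d\}$, the lift $\mathsf{li}_J(x)\in\mathbb{K}^d$ has $i$-th coordinate: $(d+1)t^{|x_i|}$ if $x_i>\mathbb{O}$ and $i\in J$; $t^{|x_i|}$ if $x_i>\mathbb{O}$ and $i\notin J$; $-(d+1)t^{|x_i|}$ if $x_i<\mathbb{O}$ and $i\notin J$; $-t^{|x_i|}$ if $x_i<\mathbb{O}$ and $i\in J$; $0$ if $x_i=\mathbb{O}$ (here $x_i>\mathbb{O}$, $x_i<\mathbb{O}$ mean $x_i\in\mathbb{T}_{>\mathbb{O}}$, $x_i\in\mathbb{T}_{<\mathbb{O}}$). *)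

theory Defs
  imports "HOL-Analysis.Finite_Cartesian_Product"
begin

section \<open>Signed tropical numbers and the symmetrized semiring\<close>

datatype tsign = SPos | SNeg | SBal

instantiation tsign :: comm_monoid_mult
begin

definition "1 = SPos"

fun times_tsign :: "tsign \<Rightarrow> tsign \<Rightarrow> tsign" where
  "SPos * t = t"
| "SNeg * SPos = SNeg"
| "SNeg * SNeg = SPos"
| "SNeg * SBal = SBal"
| "SBal * t = SBal"

instance
proof
  fix a b c :: tsign
  show "a * b * c = a * (b * c)" by (cases a; cases b; cases c; simp)
  show "a * b = b * a" by (cases a; cases b; simp)
  show "1 * a = a" by (simp add: one_tsign_def)
qed

end

text \<open>The symmetrized semiring: \<open>TElem s r\<close> is the element of norm \<open>r\<close> and sign \<open>s\<close>,
  and \<open>TZero\<close> is the tropical zero of norm \<open>-\<infinity>\<close>.\<close>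

datatype symtrop = TZero | TElem tsign real

instantiation symtrop :: comm_semiring_1
begin

definition "0 = TZero"
definition "1 = TElem SPos 0"

fun plus_symtrop :: "symtrop \<Rightarrow> symtrop \<Rightarrow> symtrop" where
  "TZero + y = y"
| "TElem s a + TZero = TElem s a"
| "TElem s a + TElem t b =
     (if b < a then TElem s a
      else if a < b then TElem t b
      else if s = t then TElem s a
      else TElem SBal a)"

fun times_symtrop :: "symtrop \<Rightarrow> symtrop \<Rightarrow> symtrop" where
  "TZero * y = TZero"
| "TElem s a * TZero = TZero"
| "TElem s a * TElem t b = TElem (s * t) (a + b)"

instance
proof
  fix a b c :: symtrop
  show "a + b + c = a + (b + c)" by (cases a; cases b; cases c; simp)
  show "a + b = b + a" by (cases a; cases b; simp)
  show "0 + a = a" by (simp add: zero_symtrop_def)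
  show "a * b * c = a * (b * c)" by (cases a; cases b; cases c; simp add: mult.assoc)
  show "a * b = b * a" by (cases a; cases b; simp add: mult.commute)
  show "1 * a = a" by (cases a; simp add: one_symtrop_def flip: one_tsign_def)
  show "(a + b) * c = a * c + b * c"
  proof (cases a)
    case a: (TElem s r)
    show ?thesis
    proof (cases b)
      case b: (TElem t q)
      show ?thesis
      proof (cases c)
        case c: (TElem u p)
        show ?thesis unfolding a b c by (cases s; cases t; cases u; simp)
      qed (simp add: a b)
    qed (cases c; simp add: a)
  qed simp
  show "0 * a = 0" by (simp add: zero_symtrop_def)
  show "a * 0 = 0" by (cases a; simp add: zero_symtrop_def)
  show "(0::symtrop) \<noteq> 1" by (simp add: zero_symtrop_def one_symtrop_def)
qed

end

definition T_pos :: "symtrop set" where "T_pos = range (TElem SPos)"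
definition T_neg :: "symtrop set" where "T_neg = range (TElem SNeg)"
definition T_signed :: "symtrop set" where "T_signed = T_pos \<union> T_neg \<union> {0}"
definition T_balanced :: "symtrop set" where "T_balanced = range (TElem SBal) \<union> {0}"

section \<open>TC-convexity\<close>

definition signed_vectors :: "(symtrop ^ 'd) set" where
  "signed_vectors = {x. \<forall>i. x $ i \<in> T_signed}"

definition closed_halfspace :: "symtrop \<Rightarrow> symtrop ^ 'd \<Rightarrow> (symtrop ^ 'd) set" where
  "closed_halfspace a0 a =
     {x \<in> signed_vectors. a0 + (\<Sum>i\<in>UNIV. a $ i * x $ i) \<in> T_pos \<union> T_balanced}"

definition closed_halfspaces :: "(symtrop ^ 'd) set set" where
  "closed_halfspaces =
     {closed_halfspace a0 a | a0 a. a0 \<in> T_signed \<and> a \<in> signed_vectors \<and> a \<noteq> 0}"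

text \<open>Some closed halfspace contains any two given points, so this is an intersection of a
  nonempty family.\<close>

definition conv_TC2 :: "symtrop ^ 'd \<Rightarrow> symtrop ^ 'd \<Rightarrow> (symtrop ^ 'd) set" where
  "conv_TC2 x y = \<Inter>{H \<in> closed_halfspaces. x \<in> H \<and> y \<in> H}"

definition TC_convex :: "(symtrop ^ 'd) set \<Rightarrow> bool" where
  "TC_convex S \<longleftrightarrow> S \<subseteq> signed_vectors \<and> (\<forall>x\<in>S. \<forall>y\<in>S. conv_TC2 x y \<subseteq> S)"

definition conv_TC :: "(symtrop ^ 'd) set \<Rightarrow> (symtrop ^ 'd) set" where
  "conv_TC M = TC_convex hull M"

section \<open>Generalized real Puiseux series\<close>

text \<open>A series is its coefficient function. The support is the range of a strictly decreasing
  sequence that is finite or unbounded iff each of its upper sections is finite.\<close>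

typedef puiseux = "{f :: real \<Rightarrow> real. \<forall>r. finite {a. f a \<noteq> 0 \<and> r \<le> a}}"
  morphisms pcoeff Abs_puiseux
  by (rule exI[of _ "\<lambda>_. 0"]) simp

setup_lifting type_definition_puiseux

lemma upper_finite_add:
  fixes f g :: "real \<Rightarrow> real"
  assumes "\<forall>r. finite {a. f a \<noteq> 0 \<and> r \<le> a}" "\<forall>r. finite {a. g a \<noteq> 0 \<and> r \<le> a}"
  shows "finite {a. f a + g a \<noteq> 0 \<and> r \<le> a}"
proof (rule finite_subset)
  show "{a. f a + g a \<noteq> 0 \<and> r \<le> a} \<subseteq> {a. f a \<noteq> 0 \<and> r \<le> a} \<union> {a. g a \<noteq> 0 \<and> r \<le> a}" by auto
qed (use assms in simp)

lemma puiseux_eqI: "(\<And>a. pcoeff f a = pcoeff g a) \<Longrightarrow> f = g"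
  by (simp add: pcoeff_inject[symmetric] fun_eq_iff)

lemma finite_upper_section: "finite {a. pcoeff f a \<noteq> 0 \<and> r \<le> a}"
  using pcoeff[of f] by simp

lemma support_bound:
  obtains F where "\<And>a. F < a \<Longrightarrow> pcoeff f a = 0"
proof -
  let ?A = "insert 0 {a. pcoeff f a \<noteq> 0 \<and> 0 \<le> a}"
  have fin: "finite ?A" using finite_upper_section[of f 0] by simp
  have "pcoeff f a = 0" if "Max ?A < a" for a
  proof (rule ccontr)
    assume ne: "pcoeff f a \<noteq> 0"
    have "0 \<le> Max ?A" using fin by (intro Max_ge) auto
    then have "a \<in> ?A" using ne that by auto
    then show False using Max_ge[OF fin] that by fastforce
  qed
  then show ?thesis using that by blast
qed

definition conv_coeff :: "puiseux \<Rightarrow> puiseux \<Rightarrow> real \<Rightarrow> real" where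
  "conv_coeff f g r =
     (\<Sum>a | pcoeff f a \<noteq> 0 \<and> pcoeff g (r - a) \<noteq> 0. pcoeff f a * pcoeff g (r - a))"

lemma conv_coeff_eq:
  assumes "\<And>a. G < a \<Longrightarrow> pcoeff g a = 0"
    and "finite A" and "\<And>a. pcoeff f a \<noteq> 0 \<Longrightarrow> r - G \<le> a \<Longrightarrow> a \<in> A"
  shows "conv_coeff f g r = (\<Sum>a\<in>A. pcoeff f a * pcoeff g (r - a))"
  unfolding conv_coeff_def
proof (rule sum.mono_neutral_left)
  show "{a. pcoeff f a \<noteq> 0 \<and> pcoeff g (r - a) \<noteq> 0} \<subseteq> A"
  proof
    fix a assume a: "a \<in> {a. pcoeff f a \<noteq> 0 \<and> pcoeff g (r - a) \<noteq> 0}"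
    then have "\<not> G < r - a" using assms(1) by blast
    then show "a \<in> A" using a by (intro assms(3)) auto
  qed
qed (use assms(2) in auto)

instantiation puiseux :: comm_ring_1
begin

lift_definition zero_puiseux :: puiseux is "\<lambda>_. 0" by simp

lift_definition one_puiseux :: puiseux is "\<lambda>a. if a = 0 then 1 else 0" by simp

lift_definition plus_puiseux :: "puiseux \<Rightarrow> puiseux \<Rightarrow> puiseux" is "\<lambda>f g a. f a + g a"
  using upper_finite_add by blast

lift_definition uminus_puiseux :: "puiseux \<Rightarrow> puiseux" is "\<lambda>f a. - f a" by simp

definition minus_puiseux :: "puiseux \<Rightarrow> puiseux \<Rightarrow> puiseux" where
  "minus_puiseux f g = f + - g"

definition times_puiseux :: "puiseux \<Rightarrow> puiseux \<Rightarrow> puiseux" where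
  "times_puiseux f g = Abs_puiseux (conv_coeff f g)"

lemma pcoeff_times: "pcoeff (f * g) = conv_coeff f g"
proof -
  obtain F where F: "\<And>a. F < a \<Longrightarrow> pcoeff f a = 0" by (rule support_bound[of f]) blast
  obtain G where G: "\<And>a. G < a \<Longrightarrow> pcoeff g a = 0" by (rule support_bound[of g]) blast
  have "finite {a. conv_coeff f g a \<noteq> 0 \<and> r \<le> a}" for r
  proof -
    let ?A = "{a. pcoeff f a \<noteq> 0 \<and> r - G \<le> a}"
    let ?B = "{b. pcoeff g b \<noteq> 0 \<and> r - F \<le> b}"
    have "c \<in> (\<lambda>(a, b). a + b) ` (?A \<times> ?B)" if c: "conv_coeff f g c \<noteq> 0" "r \<le> c" for c
    proof -
      obtain a where a: "pcoeff f a \<noteq> 0" "pcoeff g (c - a) \<noteq> 0"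
        using c(1) unfolding conv_coeff_def by (auto elim!: sum.not_neutral_contains_not_neutral)
      have "\<not> F < a" "\<not> G < c - a" using a F G by blast+
      then have "(a, c - a) \<in> ?A \<times> ?B" using a c(2) by auto
      then show ?thesis by (rule rev_image_eqI) simp
    qed
    then have "{a. conv_coeff f g a \<noteq> 0 \<and> r \<le> a} \<subseteq> (\<lambda>(a, b). a + b) ` (?A \<times> ?B)" by blast
    then show ?thesis
      by (rule finite_subset) (intro finite_imageI finite_cartesian_product finite_upper_section)
  qed
  then show ?thesis unfolding times_puiseux_def by (intro Abs_puiseux_inverse) simp
qed

lemma pcoeff_times_eq:
  assumes "\<And>a. G < a \<Longrightarrow> pcoeff g a = 0"
    and "finite A" and "\<And>a. pcoeff f a \<noteq> 0 \<Longrightarrow> r - G \<le> a \<Longrightarrow> a \<in> A"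
  shows "pcoeff (f * g) r = (\<Sum>a\<in>A. pcoeff f a * pcoeff g (r - a))"
  unfolding pcoeff_times using assms by (rule conv_coeff_eq)

lemma puiseux_mult_commute: "f * g = g * (f :: puiseux)"
proof (rule puiseux_eqI)
  fix r
  show "pcoeff (f * g) r = pcoeff (g * f) r"
    unfolding pcoeff_times conv_coeff_def
    by (rule sum.reindex_bij_witness[of _ "\<lambda>a. r - a" "\<lambda>a. r - a"]) auto
qed

lemma puiseux_mult_left_commute: "f * (g * h) = h * (g * (f :: puiseux))"
proof (rule puiseux_eqI)
  fix r
  obtain F where F: "\<And>a. F < a \<Longrightarrow> pcoeff f a = 0" by (rule support_bound[of f]) blast
  obtain G where G: "\<And>a. G < a \<Longrightarrow> pcoeff g a = 0" by (rule support_bound[of g]) blast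
  obtain H where H: "\<And>a. H < a \<Longrightarrow> pcoeff h a = 0" by (rule support_bound[of h]) blast
  have bound: "pcoeff (p * q) a = 0"
    if "\<And>a. P < a \<Longrightarrow> pcoeff p a = 0" "\<And>a. Q < a \<Longrightarrow> pcoeff q a = 0" "P + Q < a" for p q P Q a
    unfolding pcoeff_times conv_coeff_def
  proof (rule sum.neutral, clarify)
    fix b assume "pcoeff p b \<noteq> 0" "pcoeff q (a - b) \<noteq> 0"
    then have "\<not> P < b" "\<not> Q < a - b" using that by blast+
    then show "pcoeff p b * pcoeff q (a - b) = 0" using that(3) by auto
  qed
  define A where "A = {a. pcoeff f a \<noteq> 0 \<and> r - (G + H) \<le> a}"
  define C where "C = {c. pcoeff h c \<noteq> 0 \<and> r - (G + F) \<le> c}"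
  have fin: "finite A" "finite C" unfolding A_def C_def by (rule finite_upper_section)+
  have 1: "pcoeff (f * (g * h)) r =
      (\<Sum>a\<in>A. \<Sum>c\<in>C. pcoeff f a * (pcoeff h c * pcoeff g (r - a - c)))"
  proof -
    have "pcoeff (f * (g * h)) r = (\<Sum>a\<in>A. pcoeff f a * pcoeff (g * h) (r - a))"
      by (rule pcoeff_times_eq[where G = "G + H"]) (use bound[OF G H] fin in \<open>auto simp: A_def\<close>)
    also have "\<dots> = (\<Sum>a\<in>A. pcoeff f a * (\<Sum>c\<in>C. pcoeff h c * pcoeff g (r - a - c)))"
    proof (rule sum.cong)
      fix a assume "a \<in> A"
      then have "pcoeff f a \<noteq> 0" by (simp add: A_def)
      then have "a \<le> F" using F not_le_imp_less by blast
      then have "pcoeff (h * g) (r - a) = (\<Sum>c\<in>C. pcoeff h c * pcoeff g (r - a - c))"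
        by (intro pcoeff_times_eq[where G = G]) (use G fin in \<open>auto simp: C_def\<close>)
      then show "pcoeff f a * pcoeff (g * h) (r - a) =
          pcoeff f a * (\<Sum>c\<in>C. pcoeff h c * pcoeff g (r - a - c))"
        by (simp add: puiseux_mult_commute[of g h])
    qed simp
    finally show ?thesis by (simp add: sum_distrib_left)
  qed
  have 2: "pcoeff (h * (g * f)) r =
      (\<Sum>c\<in>C. \<Sum>a\<in>A. pcoeff h c * (pcoeff f a * pcoeff g (r - c - a)))"
  proof -
    have "pcoeff (h * (g * f)) r = (\<Sum>c\<in>C. pcoeff h c * pcoeff (g * f) (r - c))"
      by (rule pcoeff_times_eq[where G = "G + F"]) (use bound[OF G F] fin in \<open>auto simp: C_def\<close>)
    also have "\<dots> = (\<Sum>c\<in>C. pcoeff h c * (\<Sum>a\<in>A. pcoeff f a * pcoeff g (r - c - a)))"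
    proof (rule sum.cong)
      fix c assume "c \<in> C"
      then have "pcoeff h c \<noteq> 0" by (simp add: C_def)
      then have "c \<le> H" using H not_le_imp_less by blast
      then have "pcoeff (f * g) (r - c) = (\<Sum>a\<in>A. pcoeff f a * pcoeff g (r - c - a))"
        by (intro pcoeff_times_eq[where G = G]) (use G fin in \<open>auto simp: A_def\<close>)
      then show "pcoeff h c * pcoeff (g * f) (r - c) =
          pcoeff h c * (\<Sum>a\<in>A. pcoeff f a * pcoeff g (r - c - a))"
        by (simp add: puiseux_mult_commute[of g f])
    qed simp
    finally show ?thesis by (simp add: sum_distrib_left)
  qed
  have "(\<Sum>a\<in>A. \<Sum>c\<in>C. pcoeff f a * (pcoeff h c * pcoeff g (r - a - c))) =
      (\<Sum>c\<in>C. \<Sum>a\<in>A. pcoeff h c * (pcoeff f a * pcoeff g (r - c - a)))"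
    by (subst sum.swap) (simp add: algebra_simps)
  then show "pcoeff (f * (g * h)) r = pcoeff (h * (g * f)) r"
    by (simp add: 1 2)
qed

instance
proof
  fix a b c :: puiseux
  show "a + b + c = a + (b + c)" by transfer (simp add: add.assoc)
  show "a + b = b + a" by transfer (simp add: add.commute)
  show "0 + a = a" by transfer simp
  show "- a + a = 0" by transfer simp
  show "a - b = a + - b" by (rule minus_puiseux_def)
  show "a * b = b * a" by (rule puiseux_mult_commute)
  show "a * b * c = a * (b * c)"
    by (metis puiseux_mult_commute puiseux_mult_left_commute)
  show "1 * a = a"
  proof (rule puiseux_eqI)
    fix r
    obtain F where F: "\<And>x. F < x \<Longrightarrow> pcoeff a x = 0" by (rule support_bound[of a]) blast
    have "pcoeff (1 * a) r = (\<Sum>x\<in>{0}. pcoeff 1 x * pcoeff a (r - x))"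
      by (rule pcoeff_times_eq[OF F]) (auto simp: one_puiseux.rep_eq split: if_splits)
    then show "pcoeff (1 * a) r = pcoeff a r" by (simp add: one_puiseux.rep_eq)
  qed
  show "(a + b) * c = a * c + b * c"
  proof (rule puiseux_eqI)
    fix r
    obtain G where G: "\<And>x. G < x \<Longrightarrow> pcoeff c x = 0" by (rule support_bound[of c]) blast
    let ?A = "{x. pcoeff a x \<noteq> 0 \<and> r - G \<le> x} \<union> {x. pcoeff b x \<noteq> 0 \<and> r - G \<le> x}"
    have fin: "finite ?A" using finite_upper_section by simp
    have "pcoeff (a * c) r = (\<Sum>x\<in>?A. pcoeff a x * pcoeff c (r - x))"
      by (rule pcoeff_times_eq[OF G fin]) auto
    moreover have "pcoeff (b * c) r = (\<Sum>x\<in>?A. pcoeff b x * pcoeff c (r - x))"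
      by (rule pcoeff_times_eq[OF G fin]) auto
    moreover have "pcoeff ((a + b) * c) r = (\<Sum>x\<in>?A. pcoeff (a + b) x * pcoeff c (r - x))"
      by (rule pcoeff_times_eq[OF G fin]) (auto simp: plus_puiseux.rep_eq)
    ultimately show "pcoeff ((a + b) * c) r = pcoeff (a * c + b * c) r"
      by (simp add: plus_puiseux.rep_eq sum.distrib distrib_right)
  qed
  have "pcoeff 0 0 \<noteq> pcoeff 1 0" by (simp add: zero_puiseux.rep_eq one_puiseux.rep_eq)
  then show "(0::puiseux) \<noteq> 1" by metis
qed

end

lemma pcoeff_zero [simp]: "pcoeff 0 a = 0"
  by (simp add: zero_puiseux.rep_eq)

lemma pcoeff_one: "pcoeff 1 a = (if a = 0 then 1 else 0)"
  by (simp add: one_puiseux.rep_eq)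

lemma pcoeff_add [simp]: "pcoeff (f + g) a = pcoeff f a + pcoeff g a"
  by (simp add: plus_puiseux.rep_eq)

lemma pcoeff_uminus [simp]: "pcoeff (- f) a = - pcoeff f a"
  by (simp add: uminus_puiseux.rep_eq)

lemma pcoeff_diff [simp]: "pcoeff (f - g) a = pcoeff f a - pcoeff g a"
  unfolding minus_puiseux_def pcoeff_add pcoeff_uminus by simp

lemma pcoeff_sum [simp]: "pcoeff (sum f I) a = (\<Sum>i\<in>I. pcoeff (f i) a)"
  by (induction I rule: infinite_finite_induct) auto

lemma leading_exponent_exists:
  assumes "f \<noteq> 0"
  shows "\<exists>a. pcoeff f a \<noteq> 0 \<and> (\<forall>b>a. pcoeff f b = 0)"
proof -
  obtain r where r: "pcoeff f r \<noteq> 0"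
    using assms puiseux_eqI[of f 0] by auto
  let ?A = "{a. pcoeff f a \<noteq> 0 \<and> r \<le> a}"
  have fin: "finite ?A" by (rule finite_upper_section)
  have ne: "?A \<noteq> {}" using r by auto
  have in_A: "Max ?A \<in> ?A" using Max_in[OF fin ne] .
  have "pcoeff f b = 0" if "b > Max ?A" for b
  proof (rule ccontr)
    assume "pcoeff f b \<noteq> 0"
    moreover have "r \<le> b" using in_A that by auto
    ultimately have "b \<le> Max ?A" using fin by (intro Max_ge) auto
    then show False using that by simp
  qed
  then show ?thesis using in_A by blast
qed

lift_definition pmonom :: "real \<Rightarrow> real \<Rightarrow> puiseux" is "\<lambda>c a b. if b = a then c else 0"
  by (rule finite_subset[of _ "{_}"]) (auto split: if_splits)

abbreviation tpow :: "real \<Rightarrow> puiseux" where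
  "tpow a \<equiv> pmonom 1 a"

definition lead_exp :: "puiseux \<Rightarrow> real" where
  "lead_exp f = (GREATEST a. pcoeff f a \<noteq> 0)"

lemma lead_exp_eqI:
  assumes "pcoeff f a \<noteq> 0" "\<And>b. a < b \<Longrightarrow> pcoeff f b = 0"
  shows "lead_exp f = a"
  unfolding lead_exp_def using assms by (intro Greatest_equality) (auto simp: not_less[symmetric])

lemma lead_exp:
  assumes "f \<noteq> 0"
  shows pcoeff_lead_exp: "pcoeff f (lead_exp f) \<noteq> 0"
    and pcoeff_gt_lead_exp: "lead_exp f < b \<Longrightarrow> pcoeff f b = 0"
proof -
  obtain a where a: "pcoeff f a \<noteq> 0" "\<forall>b>a. pcoeff f b = 0"
    using leading_exponent_exists[OF assms] by auto
  then have "lead_exp f = a" by (intro lead_exp_eqI) auto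
  then show "pcoeff f (lead_exp f) \<noteq> 0" "lead_exp f < b \<Longrightarrow> pcoeff f b = 0" using a by auto
qed

text \<open>The leading coefficient of a product is the product of the leading coefficients.\<close>

lemma pcoeff_times_top:
  assumes "\<And>b. F < b \<Longrightarrow> pcoeff f b = 0" "\<And>b. G < b \<Longrightarrow> pcoeff g b = 0"
  shows "pcoeff (f * g) (F + G) = pcoeff f F * pcoeff g G"
    and "F + G < r \<Longrightarrow> pcoeff (f * g) r = 0"
proof -
  have "pcoeff (f * g) (F + G) = (\<Sum>a\<in>{F}. pcoeff f a * pcoeff g (F + G - a))"
  proof (rule pcoeff_times_eq[where G = G])
    fix a assume "pcoeff f a \<noteq> 0" "F + G - G \<le> a"
    moreover from this(1) have "\<not> F < a" using assms(1) by blast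
    ultimately show "a \<in> {F}" by simp
  qed (use assms in auto)
  then show "pcoeff (f * g) (F + G) = pcoeff f F * pcoeff g G" by simp
  assume r: "F + G < r"
  have "pcoeff (f * g) r = (\<Sum>a\<in>{}. pcoeff f a * pcoeff g (r - a))"
  proof (rule pcoeff_times_eq[where G = G])
    fix a assume "pcoeff f a \<noteq> 0" "r - G \<le> a"
    moreover from this r have "F < a" by simp
    ultimately show "a \<in> {}" using assms(1) by blast
  qed (use assms in auto)
  then show "pcoeff (f * g) r = 0" by simp
qed

lemma pmonom_mult: "pmonom c a * pmonom d b = pmonom (c * d) (a + b)"
proof (rule puiseux_eqI)
  fix r
  have "pcoeff (pmonom c a * pmonom d b) r = (\<Sum>x\<in>{a}. pcoeff (pmonom c a) x * pcoeff (pmonom d b) (r - x))"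
    by (rule pcoeff_times_eq[where G = b]) (auto simp: pmonom.rep_eq split: if_splits)
  then show "pcoeff (pmonom c a * pmonom d b) r = pcoeff (pmonom (c * d) (a + b)) r"
    by (auto simp: pmonom.rep_eq)
qed

lemma one_minus_inverse_exists:
  assumes e: "e > 0" and z: "\<And>a. - e < a \<Longrightarrow> pcoeff z a = 0"
  shows "\<exists>y. (1 - z) * y = 1"
proof -
  have pow: "pcoeff (z ^ n) a = 0" if "- (real n * e) < a" for n a
    using that
  proof (induction n arbitrary: a)
    case (Suc n)
    have "pcoeff (z * z ^ n) a = 0"
      by (rule pcoeff_times_top(2)[where F = "- e" and G = "- (real n * e)"])
        (use z Suc in \<open>auto simp: algebra_simps\<close>)
    then show ?case by simp
  qed (simp add: pcoeff_one)
  define N where "N r = nat \<lceil>- r / e\<rceil>" for r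
  define s where "s n = (\<Sum>k\<le>n. z ^ k)" for n
  define y where "y r = pcoeff (s (N r)) r" for r
  have N: "- (real n * e) < r" if "N r < n" for r n
  proof -
    have "- r / e < real n" using that unfolding N_def by linarith
    then show ?thesis using e by (simp add: field_simps)
  qed
  have N_anti: "N q \<le> N r" if "r \<le> q" for q r
    unfolding N_def using that e by (intro nat_mono ceiling_mono divide_right_mono) auto
  have y_eq: "y r = pcoeff (s n) r" if "N r \<le> n" for r n
    unfolding y_def s_def pcoeff_sum
    by (rule sum.mono_neutral_left) (use that N pow in \<open>auto simp: not_le\<close>)
  have fin: "finite {a. y a \<noteq> 0 \<and> r \<le> a}" for r
  proof (rule finite_subset[OF _ finite_upper_section[of "s (N r)" r]])
    show "{a. y a \<noteq> 0 \<and> r \<le> a} \<subseteq> {a. pcoeff (s (N r)) a \<noteq> 0 \<and> r \<le> a}"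
      using y_eq[OF N_anti] by auto
  qed
  define Y where "Y = Abs_puiseux y"
  have Y: "pcoeff Y = y" unfolding Y_def using fin by (intro Abs_puiseux_inverse) simp
  have s_top: "pcoeff (s n) a = 0" if "0 < a" for n a
    unfolding s_def pcoeff_sum
  proof (rule sum.neutral, clarify)
    fix k
    have "- (real k * e) \<le> 0" using e by simp
    then show "pcoeff (z ^ k) a = 0" using that by (intro pow) linarith
  qed
  have Y_top: "pcoeff Y a = 0" if "0 < a" for a
    using s_top that by (simp add: Y y_def)
  have "(1 - z) * Y = 1"
  proof (rule puiseux_eqI)
    fix r
    let ?n = "N r"
    let ?A = "{a. pcoeff z a \<noteq> 0 \<and> r - 0 \<le> a}"
    have "pcoeff (z * Y) r = (\<Sum>a\<in>?A. pcoeff z a * pcoeff Y (r - a))"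
      by (rule pcoeff_times_eq[OF Y_top finite_upper_section]) auto
    also have "\<dots> = (\<Sum>a\<in>?A. pcoeff z a * pcoeff (s ?n) (r - a))"
    proof (rule sum.cong)
      fix a assume "a \<in> ?A"
      then have "a \<le> - e" using z not_le_imp_less by blast
      then have "r \<le> r - a" using e by simp
      then show "pcoeff z a * pcoeff Y (r - a) = pcoeff z a * pcoeff (s ?n) (r - a)"
        using y_eq N_anti by (simp add: Y)
    qed simp
    also have "\<dots> = pcoeff (z * s ?n) r"
      by (rule pcoeff_times_eq[OF s_top finite_upper_section, symmetric]) auto
    finally have zY: "pcoeff (z * Y) r = pcoeff (z * s ?n) r" .
    have "pcoeff ((1 - z) * Y) r = pcoeff (s ?n) r - pcoeff (z * s ?n) r"
      by (simp add: left_diff_distrib zY Y y_def)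
    also have "\<dots> = pcoeff ((1 - z) * s ?n) r"
      by (simp add: left_diff_distrib)
    also have "(1 - z) * s ?n = 1 - z ^ Suc ?n"
      unfolding s_def by (rule one_diff_power_eq'[symmetric, unfolded lessThan_Suc_atMost] sum_gp_basic)
    also have "pcoeff (1 - z ^ Suc ?n) r = pcoeff 1 r"
      using pow[OF N[of r "Suc ?n"]] by simp
    finally show "pcoeff ((1 - z) * Y) r = pcoeff 1 r" .
  qed
  then show ?thesis by blast
qed

lemma puiseux_inverse_exists:
  assumes "f \<noteq> (0 :: puiseux)"
  shows "\<exists>g. f * g = 1"
proof -
  let ?a = "lead_exp f" and ?c = "pcoeff f (lead_exp f)"
  note c = lead_exp[OF assms]
  define m where "m = pmonom (1 / ?c) (- ?a)"
  define z where "z = 1 - m * f"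
  have m_top: "pcoeff m b = 0" if "- ?a < b" for b
    using that by (simp add: m_def pmonom.rep_eq)
  have mf0: "pcoeff (m * f) 0 = 1"
    using pcoeff_times_top(1)[where F = "- ?a" and G = ?a, OF m_top c(2)] c(1) by (simp add: m_def pmonom.rep_eq)
  have mf_gt: "pcoeff (m * f) b = 0" if "0 < b" for b
    using pcoeff_times_top(2)[where F = "- ?a" and G = ?a and r = b, OF m_top c(2)] that by simp
  have z_top: "pcoeff z b = 0" if "0 \<le> b" for b
    using that mf0 mf_gt[of b] by (cases "b = 0") (auto simp: z_def pcoeff_one)
  have "\<exists>e>0. \<forall>a. - e < a \<longrightarrow> pcoeff z a = 0"
  proof (cases "z = 0")
    case True
    then show ?thesis by (intro exI[of _ 1]) simp
  next
    case False
    have "lead_exp z < 0" using lead_exp(1)[OF False] z_top not_le_imp_less by blast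
    then show ?thesis using lead_exp(2)[OF False] by (intro exI[of _ "- lead_exp z"]) simp
  qed
  then obtain e where "e > 0" "\<And>a. - e < a \<Longrightarrow> pcoeff z a = 0" by blast
  from one_minus_inverse_exists[OF this] obtain y where "(1 - z) * y = 1" by blast
  then have "f * (m * y) = 1" by (simp add: z_def mult.assoc mult.left_commute)
  then show ?thesis by blast
qed

instantiation puiseux :: linordered_field
begin

text \<open>\<open>f < g\<close> iff the leading coefficient of \<open>g - f\<close> is positive.\<close>

definition less_puiseux :: "puiseux \<Rightarrow> puiseux \<Rightarrow> bool" where
  "f < g \<longleftrightarrow> (\<exists>a. 0 < pcoeff (g - f) a \<and> (\<forall>b>a. pcoeff (g - f) b = 0))"

definition less_eq_puiseux :: "puiseux \<Rightarrow> puiseux \<Rightarrow> bool" where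
  "(f :: puiseux) \<le> g \<longleftrightarrow> f < g \<or> f = g"

definition abs_puiseux :: "puiseux \<Rightarrow> puiseux" where
  "\<bar>f :: puiseux\<bar> = (if f < 0 then - f else f)"

definition sgn_puiseux :: "puiseux \<Rightarrow> puiseux" where
  "sgn (f :: puiseux) = (if f = 0 then 0 else if 0 < f then 1 else - 1)"

definition inverse_puiseux :: "puiseux \<Rightarrow> puiseux" where
  "inverse (f :: puiseux) = (if f = 0 then 0 else THE g. f * g = 1)"

definition divide_puiseux :: "puiseux \<Rightarrow> puiseux \<Rightarrow> puiseux" where
  "(f :: puiseux) div g = f * inverse g"

lemma puiseux_pos_iff: "0 < f \<longleftrightarrow> f \<noteq> 0 \<and> 0 < pcoeff f (lead_exp f)" for f :: puiseux
proof
  assume "0 < f"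
  then obtain a where a: "0 < pcoeff f a" "\<forall>b>a. pcoeff f b = 0" by (auto simp: less_puiseux_def)
  then have "lead_exp f = a" by (intro lead_exp_eqI) auto
  then show "f \<noteq> 0 \<and> 0 < pcoeff f (lead_exp f)" using a by auto
next
  assume "f \<noteq> 0 \<and> 0 < pcoeff f (lead_exp f)"
  then show "0 < f" using lead_exp(2)[of f] by (auto simp: less_puiseux_def)
qed

lemma puiseux_less_iff: "f < g \<longleftrightarrow> 0 < g - f" for f g :: puiseux
  by (simp add: less_puiseux_def)

lemma puiseux_pos_add: "0 < f + g" if fg: "0 < f" "0 < g" for f g :: puiseux
proof -
  obtain a where a: "0 < pcoeff f a" "\<forall>b>a. pcoeff f b = 0"
    using fg(1) by (auto simp: less_puiseux_def)
  obtain c where c: "0 < pcoeff g c" "\<forall>b>c. pcoeff g b = 0"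
    using fg(2) by (auto simp: less_puiseux_def)
  have "0 < pcoeff (f + g) (max a c)" "\<forall>b>max a c. pcoeff (f + g) b = 0"
    using a c by (cases a c rule: linorder_cases; auto simp: max_def)+
  then show ?thesis unfolding less_puiseux_def by auto
qed

lemma puiseux_pos_mult: "0 < f * g" if fg: "0 < f" "0 < g" for f g :: puiseux
proof -
  obtain a where a: "0 < pcoeff f a" "\<forall>b>a. pcoeff f b = 0"
    using fg(1) by (auto simp: less_puiseux_def)
  obtain c where c: "0 < pcoeff g c" "\<forall>b>c. pcoeff g b = 0"
    using fg(2) by (auto simp: less_puiseux_def)
  have "pcoeff (f * g) (a + c) = pcoeff f a * pcoeff g c"
    "\<And>b. a + c < b \<Longrightarrow> pcoeff (f * g) b = 0"
    using pcoeff_times_top[of a f c g] a(2) c(2) by auto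
  then show ?thesis unfolding less_puiseux_def using a(1) c(1) by (auto intro!: exI[of _ "a + c"])
qed

lemma puiseux_trichotomy: "f = 0 \<or> 0 < f \<or> 0 < - f" for f :: puiseux
proof (cases "f = 0")
  case False
  note l = lead_exp[OF False]
  show ?thesis
  proof (cases "0 < pcoeff f (lead_exp f)")
    case True
    then show ?thesis using False by (simp add: puiseux_pos_iff)
  next
    case neg: False
    have "lead_exp (- f) = lead_exp f" using l by (intro lead_exp_eqI) auto
    then show ?thesis using l neg False by (simp add: puiseux_pos_iff)
  qed
qed simp

lemma puiseux_irrefl: "\<not> 0 < (0 :: puiseux)"
  by (simp add: puiseux_pos_iff)

instance
proof
  fix f g h :: puiseux
  show lt: "(f < g) = (f \<le> g \<and> \<not> g \<le> f)"
    unfolding less_eq_puiseux_def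
    using puiseux_pos_add[of "g - f" "f - g"] puiseux_irrefl
    by (auto simp: puiseux_less_iff[of f g] puiseux_less_iff[of g f])
  show "f \<le> f" by (simp add: less_eq_puiseux_def)
  show "f \<le> g \<Longrightarrow> g \<le> h \<Longrightarrow> f \<le> h"
    unfolding less_eq_puiseux_def
    using puiseux_pos_add[of "g - f" "h - g"]
    by (auto simp: puiseux_less_iff[of f g] puiseux_less_iff[of g h] puiseux_less_iff[of f h])
  show "f \<le> g \<Longrightarrow> g \<le> f \<Longrightarrow> f = g"
    using lt unfolding less_eq_puiseux_def by metis
  show "f \<le> g \<Longrightarrow> h + f \<le> h + g"
    by (auto simp: less_eq_puiseux_def puiseux_less_iff[of f g] puiseux_less_iff[of "h + f"])
  show "f \<le> g \<or> g \<le> f"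
    unfolding less_eq_puiseux_def
    using puiseux_trichotomy[of "g - f"]
    by (auto simp: puiseux_less_iff[of f g] puiseux_less_iff[of g f])
  show "f < g \<Longrightarrow> 0 < h \<Longrightarrow> h * f < h * g"
    using puiseux_pos_mult[of h "g - f"]
    by (simp add: puiseux_less_iff[of f g] puiseux_less_iff[of "h * f"] right_diff_distrib)
  show "\<bar>f\<bar> = (if f < 0 then - f else f)" by (rule abs_puiseux_def)
  show "sgn f = (if f = 0 then 0 else if 0 < f then 1 else - 1)" by (rule sgn_puiseux_def)
  show "inverse (0 :: puiseux) = 0" by (simp add: inverse_puiseux_def)
  show "f div g = f * inverse g" by (rule divide_puiseux_def)
  show "inverse f * f = 1" if nz: "f \<noteq> 0"
  proof -
    obtain k where k: "f * k = 1" using puiseux_inverse_exists[OF nz] by blast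
    have "(THE g. f * g = 1) = k"
    proof (rule the_equality)
      show "f * k = 1" by (rule k)
      fix g assume "f * g = 1"
      then show "g = k" using k by (metis mult.assoc mult.commute mult_1)
    qed
    then show ?thesis using nz k by (simp add: inverse_puiseux_def mult.commute)
  qed
qed

end

section \<open>Convex hulls over an ordered field\<close>

text \<open>The library's \<open>convex\<close> is restricted to real vector spaces; this is the same definition
  with scalars from \<open>'a\<close>.\<close>

definition vec_convex :: "('a::linordered_field ^ 'd) set \<Rightarrow> bool" where
  "vec_convex S \<longleftrightarrow>
     (\<forall>x\<in>S. \<forall>y\<in>S. \<forall>u\<ge>0. \<forall>v\<ge>0. u + v = 1 \<longrightarrow> u *s x + v *s y \<in> S)"

section \<open>Signed valuation and lifts\<close>

definition sval :: "puiseux \<Rightarrow> symtrop" where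
  "sval f =
     (if f = 0 then 0 else if 0 < f then TElem SPos (lead_exp f) else TElem SNeg (lead_exp f))"

definition sval_vec :: "puiseux ^ 'd \<Rightarrow> symtrop ^ 'd" where
  "sval_vec v = (\<chi> i. sval (v $ i))"

text \<open>Lifts are only meaningful for signed vectors; the value at a balanced entry is a dummy.\<close>

definition lift_J :: "'d set \<Rightarrow> symtrop ^ 'd \<Rightarrow> puiseux ^ 'd" where
  "lift_J J x =
     (\<chi> i. case x $ i of
        TZero \<Rightarrow> 0
      | TElem SPos r \<Rightarrow> if i \<in> J then of_nat (CARD('d) + 1) * tpow r else tpow r
      | TElem SNeg r \<Rightarrow> if i \<in> J then - tpow r else - (of_nat (CARD('d) + 1) * tpow r)
      | TElem SBal r \<Rightarrow> 0)"

end

theory Submission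
  imports Defs "HOL-Library.Extended_Real"
begin

text \<open>A functional that is nonnegative at \<open>X\<close> and \<open>Y\<close> tropicalises to a closed halfspace containing
  their valuations. Applied to functionals in at most two variables, together with Helly's theorem
  for intervals of the segment parameter, this shows that the valuation of a convex set is
  TC-convex; hence the TC-hull lies in the valuation of the hull of every lift.

  Conversely, let \<open>z\<close> lie in the valuations of the hulls of all the lifts \<open>li_J\<close>. The factor
  \<open>d + 1\<close> in \<open>li_J\<close> ensures that, when the generators are composed in a suitable order (ties
  being resolved in favour of the earlier one), the result lies beyond \<open>z\<close>: outside the
  symmetric interval around zero given by the norm of each coordinate of \<open>z\<close>, on the side
  prescribed by \<open>J\<close>. So every sign pattern is realised beyond \<open>z\<close> by a point of the TC-hull.
  The coordinates are then fixed to those of \<open>z\<close> one at a time: two points with opposite patterns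
  at a coordinate are scaled to tie there, and if this is their only tie, the TC-hull contains all
  intermediate values. The other ties have exactly the norm of \<open>z\<close>, and are removed first, by
  points obtained inductively for patterns that agree with the signs of \<open>z\<close> in more coordinates.\<close>

section \<open>Norms and dominant terms\<close>

definition tnorm :: "symtrop \<Rightarrow> ereal" where
  "tnorm x = (case x of TZero \<Rightarrow> -\<infinity> | TElem s r \<Rightarrow> ereal r)"

lemma TElem_neq_zero [simp]: "TElem s r \<noteq> 0" "0 \<noteq> TElem s r"
  by (simp_all add: zero_symtrop_def)

lemma tnorm_simps [simp]: "tnorm TZero = -\<infinity>" "tnorm 0 = -\<infinity>" "tnorm (TElem s r) = ereal r"
  by (simp_all add: tnorm_def zero_symtrop_def)

lemma tnorm_eq_minus_infinity [simp]: "tnorm x = -\<infinity> \<longleftrightarrow> x = 0"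
  by (cases x) (auto simp: zero_symtrop_def)

lemma tnorm_mult: "tnorm (x * y) = tnorm x + tnorm y"
  by (cases x; cases y) auto

lemma symtrop_mult_eq_0_iff: "(x::symtrop) * y = 0 \<longleftrightarrow> x = 0 \<or> y = 0"
  by (cases x; cases y) (auto simp: zero_symtrop_def)

lemma tnorm_mult_le_iff: "a \<noteq> 0 \<Longrightarrow> tnorm (a * x) \<le> tnorm (a * y) \<longleftrightarrow> tnorm x \<le> tnorm y"
  by (cases a; cases x; cases y) (auto simp: zero_symtrop_def)

lemma signed_iff: "x \<in> T_signed \<longleftrightarrow> x = 0 \<or> x \<in> T_pos \<or> x \<in> T_neg"
  by (auto simp: T_signed_def)

lemma TElem_mem [simp]:
  "TElem s r \<in> T_pos \<longleftrightarrow> s = SPos" "TElem s r \<in> T_neg \<longleftrightarrow> s = SNeg"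
  "TElem s r \<in> T_balanced \<longleftrightarrow> s = SBal" "TElem s r \<in> T_signed \<longleftrightarrow> s \<noteq> SBal"
  "0 \<notin> T_pos" "0 \<notin> T_neg" "0 \<in> T_balanced" "0 \<in> T_signed"
  "TZero \<notin> T_pos" "TZero \<notin> T_neg" "TZero \<in> T_balanced" "TZero \<in> T_signed"
  by (cases s; auto simp: T_pos_def T_neg_def T_balanced_def T_signed_def zero_symtrop_def)+

lemma signed_mult: "x \<in> T_signed \<Longrightarrow> y \<in> T_signed \<Longrightarrow> x * y \<in> T_signed"
  by (cases x; cases y; auto)
     (metis times_tsign.simps tsign.exhaust)+

text \<open>Expresses that a tropical sum lies in \<open>T_pos \<union> T_balanced\<close> without
  computing it: a negative term of the same maximal norm merely makes the sum balanced, and the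
  first disjunct accounts for the sum \<open>0\<close>.\<close>

definition dominant_pos :: "('a \<Rightarrow> symtrop) \<Rightarrow> 'a set \<Rightarrow> bool" where
  "dominant_pos f I \<longleftrightarrow>
     (\<forall>i\<in>I. f i = 0) \<or> (\<exists>i\<in>I. f i \<in> T_pos \<and> (\<forall>j\<in>I. tnorm (f j) \<le> tnorm (f i)))"

text \<open>The induction tracks which signs occur among the terms of top norm; a nonzero balanced
  sum means that both do. Norm and sign of a partial sum then suffice to insert a further
  term.\<close>

lemma sum_signed_cases:
  assumes "finite I" "\<And>i. i \<in> I \<Longrightarrow> f i \<in> T_signed"
  shows "(\<forall>j\<in>I. tnorm (f j) \<le> tnorm (sum f I)) \<and>
    (case sum f I of TZero \<Rightarrow> True
     | TElem s r \<Rightarrow> ((\<exists>i\<in>I. f i = TElem SPos r) \<longleftrightarrow> s \<noteq> SNeg) \<and>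
                     ((\<exists>i\<in>I. f i = TElem SNeg r) \<longleftrightarrow> s \<noteq> SPos))"
  using assms
proof (induction I rule: finite_induct)
  case empty
  then show ?case by (simp add: zero_symtrop_def)
next
  case (insert x I)
  let ?s = "sum f I"
  have IH: "(\<forall>j\<in>I. tnorm (f j) \<le> tnorm ?s) \<and>
    (case ?s of TZero \<Rightarrow> True
     | TElem s r \<Rightarrow> ((\<exists>i\<in>I. f i = TElem SPos r) \<longleftrightarrow> s \<noteq> SNeg) \<and>
                     ((\<exists>i\<in>I. f i = TElem SNeg r) \<longleftrightarrow> s \<noteq> SPos))"
    using insert by simp
  have x: "f x \<in> T_signed" using insert by simp
  have sum: "sum f (insert x I) = f x + ?s" using insert by simp
  have no: "\<not> (\<exists>i\<in>I. f i = TElem t q)" if "tnorm ?s < ereal q" for t q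
    using IH that by (metis not_le tnorm_simps(3))
  show ?case
  proof (cases "f x")
    case TZero
    then show ?thesis unfolding sum using IH by (auto split: symtrop.splits)
  next
    case (TElem t q)
    note fx = this
    have t: "t = SPos \<or> t = SNeg" using x fx by (cases t) auto
    show ?thesis
    proof (cases ?s)
      case TZero
      have "\<And>t q. \<not> (\<exists>i\<in>I. f i = TElem t q)" by (rule no) (simp add: TZero)
      then show ?thesis unfolding sum using IH t by (auto simp: fx TZero)
    next
      case (TElem s r)
      consider "q < r" | "q = r" | "r < q" by linarith
      then show ?thesis
      proof cases
        case 1
        then show ?thesis unfolding sum using IH t by (auto simp: fx TElem order.trans)
      next
        case 2
        then show ?thesis unfolding sum using IH t by (cases s) (auto simp: fx TElem)
      next
        case 3
        then have "\<And>t. \<not> (\<exists>i\<in>I. f i = TElem t q)" using no[of q] by (auto simp: TElem)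
        moreover have "\<forall>j\<in>I. tnorm (f j) \<le> ereal q" using IH 3
          by (metis TElem ereal_less_eq(3) less_imp_le order.trans tnorm_simps(3))
        ultimately show ?thesis unfolding sum using 3 t by (auto simp: fx TElem)
      qed
    qed
  qed
qed

lemma sum_nonneg_iff_dominant_pos:
  assumes "finite I" "\<And>i. i \<in> I \<Longrightarrow> f i \<in> T_signed"
  shows "sum f I \<in> T_pos \<union> T_balanced \<longleftrightarrow> dominant_pos f I"
proof -
  note c = sum_signed_cases[of I f, OF assms]
  show ?thesis
  proof (cases "sum f I")
    case TZero
    then have "\<forall>j\<in>I. f j = 0" using c by simp
    then show ?thesis by (simp add: TZero dominant_pos_def)
  next
    case (TElem s r)
    have le: "\<forall>j\<in>I. tnorm (f j) \<le> ereal r" using c TElem by simp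
    have s: "((\<exists>i\<in>I. f i = TElem SPos r) \<longleftrightarrow> s \<noteq> SNeg)"
      "((\<exists>i\<in>I. f i = TElem SNeg r) \<longleftrightarrow> s \<noteq> SPos)" using c TElem by simp_all
    have "dominant_pos f I \<longleftrightarrow> s \<noteq> SNeg"
    proof
      assume "s \<noteq> SNeg"
      then obtain i where "i \<in> I" "f i = TElem SPos r" using s by blast
      then show "dominant_pos f I" using le unfolding dominant_pos_def by (metis TElem_mem(1) tnorm_simps(3))
    next
      assume d: "dominant_pos f I"
      show "s \<noteq> SNeg"
      proof
        assume "s = SNeg"
        then obtain k where k: "k \<in> I" "f k = TElem SNeg r" using s by auto
        then obtain i where i: "i \<in> I" "f i \<in> T_pos" "\<forall>j\<in>I. tnorm (f j) \<le> tnorm (f i)"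
          using d unfolding dominant_pos_def by (metis symtrop.distinct(1) zero_symtrop_def)
        obtain q where "f i = TElem SPos q" using i(2) by (auto simp: T_pos_def)
        then have "f i = TElem SPos r" using i k le by force
        then show False using s i \<open>s = SNeg\<close> by auto
      qed
    qed
    then show ?thesis by (cases s) (auto simp: TElem)
  qed
qed

text \<open>A left-biased substitute for \<open>+\<close>: at equal norms the left argument wins, so
  signed arguments never give a nonzero balanced value.\<close>

definition compose :: "symtrop \<Rightarrow> symtrop \<Rightarrow> symtrop" where
  "compose x y = (if tnorm y \<le> tnorm x then x else y)"

text \<open>For signed arguments this means equal norm and opposite signs, which is exactly when
  \<open>x + y\<close> is balanced and nonzero.\<close>

definition opp_tie :: "symtrop \<Rightarrow> symtrop \<Rightarrow> bool" where
  "opp_tie x y \<longleftrightarrow> tnorm x = tnorm y \<and> x \<noteq> y"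

lemma tnorm_compose: "tnorm (compose x y) = max (tnorm x) (tnorm y)"
  by (auto simp: compose_def max_def)

lemma compose_cases: "P x \<Longrightarrow> P y \<Longrightarrow> P (compose x y)"
  by (simp add: compose_def)

lemma dominant_pos_cases:
  assumes "dominant_pos f UNIV"
  obtains "\<And>i. f i = 0" | i where "f i \<in> T_pos" "\<And>j. tnorm (f j) \<le> tnorm (f i)"
  using assms by (auto simp: dominant_pos_def)

lemma compose_commute: "\<not> opp_tie x y \<Longrightarrow> compose x y = compose y x"
  by (auto simp: opp_tie_def compose_def)

text \<open>The positive term at \<open>i\<close> dominates all terms of \<open>u\<close> and
  \<open>v\<close>, so \<open>v i\<close> cannot exceed \<open>u i\<close> and the left bias keeps
  \<open>u i\<close>. Away from \<open>i\<close> only the norm of \<open>w\<close> matters; this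
  freedom is what later allows a coordinate to be filled.\<close>

lemma dominant_pos_if_left_dominates:
  assumes i: "a i * u i \<in> T_pos" "\<And>j. tnorm (a j * u j) \<le> tnorm (a i * u i)"
    and v: "\<And>j. tnorm (a j * v j) \<le> tnorm (a i * u i)"
    and wi: "w i = compose (u i) (v i)"
    and w: "\<And>j. tnorm (w j) \<le> max (tnorm (u j)) (tnorm (v j))"
  shows "dominant_pos (\<lambda>i. a i * w i) UNIV"
proof -
  have "a i \<noteq> 0" using i(1) by auto
  then have "tnorm (v i) \<le> tnorm (u i)" using v[of i] tnorm_mult_le_iff by blast
  then have wi: "w i = u i" using wi by (simp add: compose_def)
  have "tnorm (a j * w j) \<le> tnorm (a i * u i)" for j
  proof (cases "a j = 0")
    case False
    have "tnorm (w j) \<le> tnorm (u j) \<or> tnorm (w j) \<le> tnorm (v j)" using w[of j] by (auto simp: max_def split: if_splits)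
    then show ?thesis using i(2)[of j] v[of j] False tnorm_mult_le_iff order.trans by blast
  qed simp
  then show ?thesis using i(1) wi unfolding dominant_pos_def by (intro disjI2 bexI[of _ i]) simp_all
qed

text \<open>Either a positive top term of \<open>u\<close> dominates both vectors, or
  \<open>v\<close> has a strictly larger one. Strictness excludes a tie at its index, so the left
  bias does no harm there.\<close>

lemma dominant_pos_compose:
  assumes u: "dominant_pos (\<lambda>i. a i * u i) UNIV" and v: "dominant_pos (\<lambda>i. a i * v i) UNIV"
  shows "dominant_pos (\<lambda>i. a i * compose (u i) (v i)) UNIV"
  using u
proof (cases rule: dominant_pos_cases)
  case z: 1
  have z: "a i = 0 \<or> u i = 0" for i using z[of i] by (simp add: symtrop_mult_eq_0_iff)
  then have "a i * compose (u i) (v i) = a i * v i" for i using z[of i] by (cases "u i = 0") (auto simp: compose_def)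
  then show ?thesis using v by simp
next
  case i: (2 i)
  show ?thesis
  proof (cases "\<forall>j. tnorm (a j * v j) \<le> tnorm (a i * u i)")
    case True
    then show ?thesis by (intro dominant_pos_if_left_dominates[of a i u v, OF i]) (simp_all add: tnorm_compose)
  next
    case False
    then obtain k where k: "tnorm (a i * u i) < tnorm (a k * v k)" by (auto simp: not_le)
    from v show ?thesis
    proof (cases rule: dominant_pos_cases)
      case 1
      then show ?thesis using k by simp
    next
      case j: (2 j)
      have lt: "tnorm (a l * u l) < tnorm (a j * v j)" for l using i(2)[of l] k j(2)[of k] by order
      have "a j \<noteq> 0" using j(1) by auto
      then have "tnorm (u j) < tnorm (v j)" using lt[of j] tnorm_mult_le_iff[of "a j" "v j" "u j"] by (simp add: not_le[symmetric])
      then have c: "compose (u j) (v j) = compose (v j) (u j)" by (auto simp: compose_def)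
      show ?thesis
      proof (rule dominant_pos_if_left_dominates[of a j v u "\<lambda>i. compose (u i) (v i)", OF j _ c])
        show "tnorm (a l * u l) \<le> tnorm (a j * v j)" for l using lt[of l] by simp
      qed (simp add: tnorm_compose max.commute)
    qed
  qed
qed

lemma opp_tie_mult_pos:
  assumes "opp_tie x y" "x \<in> T_signed" "y \<in> T_signed" "a * x \<in> T_pos"
  shows "a * y \<notin> T_pos"
proof (cases a)
  case (TElem s r)
  then show ?thesis
    using assms by (cases s; auto simp: opp_tie_def T_signed_def T_pos_def T_neg_def)
qed simp

text \<open>The critical case is \<open>i = k\<close>, where the dominant term of \<open>u\<close>
  may be overwritten. The opposite tie gives the \<open>k\<close>-th term of \<open>v\<close> the
  same norm but not the positive sign, so a dominant positive term of \<open>v\<close> sits at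
  another index, where the composition keeps it.\<close>

lemma dominant_pos_fill_le:
  assumes i: "a i * u i \<in> T_pos" "\<And>j. tnorm (a j * u j) \<le> tnorm (a i * u i)"
    and v: "dominant_pos (\<lambda>i. a i * v i) UNIV" "\<And>j. tnorm (a j * v j) \<le> tnorm (a i * u i)"
    and sg: "u k \<in> T_signed" "v k \<in> T_signed"
    and k: "opp_tie (u k) (v k)"
    and w: "\<And>i. i \<noteq> k \<Longrightarrow> w i = compose (u i) (v i)" "\<And>i. i \<noteq> k \<Longrightarrow> w i = compose (v i) (u i)"
      "tnorm (w k) \<le> tnorm (u k)"
  shows "dominant_pos (\<lambda>i. a i * w i) UNIV"
proof -
  have w_le: "tnorm (w j) \<le> max (tnorm (u j)) (tnorm (v j))" for j
    using w(1)[of j] w(3) by (cases "j = k") (auto simp: tnorm_compose le_max_iff_disj)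
  show ?thesis
  proof (cases "i = k")
    case False
    show ?thesis by (rule dominant_pos_if_left_dominates[of a i u v w, OF i v(2) w(1)[OF False] w_le])
  next
    case True
    have eq: "tnorm (a k * u k) = tnorm (a k * v k)" using k(1) by (simp add: tnorm_mult opp_tie_def)
    from v(1) show ?thesis
    proof (cases rule: dominant_pos_cases)
      case 1
      then have "tnorm (a i * u i) = -\<infinity>" using eq True by simp
      then have "a i * u i = 0" using tnorm_eq_minus_infinity by blast
      then show ?thesis using i(1) by (metis TElem_mem(5))
    next
      case j: (2 j)
      have e: "tnorm (a j * v j) = tnorm (a i * u i)" using v(2)[of j] j(2)[of k] eq True by simp
      have jk: "j \<noteq> k" using opp_tie_mult_pos[OF k sg] i(1) True j(1) by auto
      show ?thesis
      proof (rule dominant_pos_if_left_dominates[of a j v u w, OF j _ w(2)[OF jk]])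
        show "tnorm (a l * u l) \<le> tnorm (a j * v j)" for l using i(2)[of l] e by simp
        show "tnorm (w l) \<le> max (tnorm (v l)) (tnorm (u l))" for l using w_le[of l] by (simp add: max.commute)
      qed
    qed
  qed
qed

text \<open>Tropical counterpart of cancellation: two opposite terms of equal size may combine to
  anything smaller. Away from \<open>k\<close> the composition is symmetric, so the vector with the
  larger dominant term can be taken as the first argument of
  \<open>dominant_pos_fill_le\<close>.\<close>

lemma dominant_pos_fill:
  assumes u: "dominant_pos (\<lambda>i. a i * u i) UNIV" and v: "dominant_pos (\<lambda>i. a i * v i) UNIV"
    and sg: "u k \<in> T_signed" "v k \<in> T_signed"
    and k: "opp_tie (u k) (v k)" "\<And>i. i \<noteq> k \<Longrightarrow> \<not> opp_tie (u i) (v i)"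
    and w: "\<And>i. i \<noteq> k \<Longrightarrow> w i = compose (u i) (v i)" "tnorm (w k) \<le> tnorm (u k)"
  shows "dominant_pos (\<lambda>i. a i * w i) UNIV"
proof -
  have w2: "w i = compose (v i) (u i)" if "i \<noteq> k" for i
    using w(1)[OF that] compose_commute[OF k(2)[OF that]] by simp
  have k': "opp_tie (v k) (u k)" "tnorm (w k) \<le> tnorm (v k)"
    using k(1) w(2) unfolding opp_tie_def by metis+
  from u show ?thesis
  proof (cases rule: dominant_pos_cases)
    case z: 1
    from v show ?thesis
    proof (cases rule: dominant_pos_cases)
      case 1
      have "a i * w i = 0" for i
      proof (cases "a i = 0")
        case False
        then have "u i = 0" "v i = 0" using z[of i] 1[of i] by (auto simp: symtrop_mult_eq_0_iff)
        then have "w i = 0" using w by (cases "i = k") (auto simp: compose_def)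
        then show ?thesis by simp
      qed simp
      then show ?thesis by (simp add: dominant_pos_def)
    next
      case j: (2 j)
      have "tnorm (a l * u l) \<le> tnorm (a j * v j)" for l unfolding z by simp
      then show ?thesis by (rule dominant_pos_fill_le[of a j v u k w, OF j u _ sg(2,1) k'(1) w2 w(1) k'(2)])
    qed
  next
    case i: (2 i)
    show ?thesis
    proof (cases "\<forall>j. tnorm (a j * v j) \<le> tnorm (a i * u i)")
      case True
      then show ?thesis using dominant_pos_fill_le[of a i u v k w, OF i v _ sg k(1) w(1) w2 w(2)] by blast
    next
      case False
      then obtain l where l: "tnorm (a i * u i) < tnorm (a l * v l)" by (auto simp: not_le)
      from v show ?thesis
      proof (cases rule: dominant_pos_cases)
        case 1
        then show ?thesis using l by simp
      next
        case j: (2 j)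
        have "tnorm (a m * u m) \<le> tnorm (a j * v j)" for m using i(2)[of m] l j(2)[of l] by order
        then show ?thesis by (rule dominant_pos_fill_le[of a j v u k w, OF j u _ sg(2,1) k'(1) w2 w(1) k'(2)])
      qed
    qed
  qed
qed

section \<open>Merging coordinates in a TC-cone\<close>

text \<open>Interface between the halfspace arguments and the merging of coordinates: these closure
  properties hold for the cone over a TC-convex set by \<open>TC_cone_cone_of\<close>. The
  homogenizing coordinate is treated like any other.\<close>

definition TC_cone :: "('a \<Rightarrow> symtrop) set \<Rightarrow> bool" where
  "TC_cone C \<longleftrightarrow>
     (\<forall>x\<in>C. \<forall>i. x i \<in> T_signed) \<and>
     (\<forall>x\<in>C. \<forall>r. (\<lambda>i. TElem SPos r * x i) \<in> C) \<and>
     (\<forall>x\<in>C. \<forall>y\<in>C. (\<lambda>i. compose (x i) (y i)) \<in> C) \<and>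
     (\<forall>x\<in>C. \<forall>y\<in>C. \<forall>k w. opp_tie (x k) (y k) \<longrightarrow> (\<forall>i. i \<noteq> k \<longrightarrow> \<not> opp_tie (x i) (y i)) \<longrightarrow>
        w \<in> T_signed \<longrightarrow> tnorm w \<le> tnorm (x k) \<longrightarrow> (\<lambda>i. compose (x i) (y i))(k := w) \<in> C)"

lemma TC_coneD:
  assumes "TC_cone C"
  shows "x \<in> C \<Longrightarrow> x i \<in> T_signed"
    and "x \<in> C \<Longrightarrow> (\<lambda>i. TElem SPos r * x i) \<in> C"
    and "x \<in> C \<Longrightarrow> y \<in> C \<Longrightarrow> (\<lambda>i. compose (x i) (y i)) \<in> C"
    and "x \<in> C \<Longrightarrow> y \<in> C \<Longrightarrow> opp_tie (x k) (y k) \<Longrightarrow> (\<And>i. i \<noteq> k \<Longrightarrow> \<not> opp_tie (x i) (y i)) \<Longrightarrow>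
        w \<in> T_signed \<Longrightarrow> tnorm w \<le> tnorm (x k) \<Longrightarrow> (\<lambda>i. compose (x i) (y i))(k := w) \<in> C"
  using assms unfolding TC_cone_def by blast+

section \<open>Prescribed signs, scaling down and admissible entries\<close>

definition T_sgn :: "bool \<Rightarrow> symtrop set" where
  "T_sgn b = (if b then T_pos else T_neg)"

lemma T_sgn_opp_tie: "x \<in> T_sgn b \<union> {0} \<Longrightarrow> y \<in> T_sgn b \<union> {0} \<Longrightarrow> \<not> opp_tie x y"
  by (auto simp: T_sgn_def opp_tie_def T_pos_def T_neg_def split: if_splits)

lemma T_sgn_mult: "TElem SPos r * x \<in> T_sgn b \<longleftrightarrow> x \<in> T_sgn b"
  by (cases x) (auto simp: T_sgn_def)

lemma TElem_SPos_mult_zero_iff [simp]: "TElem SPos r * x = 0 \<longleftrightarrow> x = 0"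
  by (simp add: symtrop_mult_eq_0_iff)

lemma signed_cases_T_sgn:
  assumes "x \<in> T_signed" obtains "x = 0" | "x \<in> T_sgn b" | "x \<in> T_sgn (\<not> b)"
  using assms unfolding T_sgn_def signed_iff by (cases b) auto

lemma T_sgn_eqI: "x \<in> T_sgn b \<Longrightarrow> y \<in> T_sgn b \<Longrightarrow> tnorm x = tnorm y \<Longrightarrow> x = y"
  by (auto simp: T_sgn_def T_pos_def T_neg_def split: if_splits)

lemma T_sgn_scale_to:
  assumes "x \<in> T_sgn b" "y \<in> T_sgn c" "tnorm y \<le> tnorm x"
  obtains r where "r \<le> 0" "tnorm (TElem SPos r * x) = tnorm y"
proof -
  obtain s q t p where "x = TElem s q" "y = TElem t p"
    using assms by (auto simp: T_sgn_def T_pos_def T_neg_def split: if_splits)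
  then show ?thesis using that[of "p - q"] assms(3) by simp
qed

lemma scale_nonpos_cases: "r \<le> 0 \<Longrightarrow> tnorm (TElem SPos r * x) < tnorm x \<or> TElem SPos r * x = x"
  by (cases x) auto

lemma tnorm_scale_le: "r \<le> 0 \<Longrightarrow> tnorm (TElem SPos r * x) \<le> tnorm x"
  by (cases x) auto

text \<open>The part of \<open>beyond\<close> that survives scaling down. Entries of norm at most
  that of \<open>z\<close> are free in sign, unless \<open>z\<close> itself has the prescribed sign;
  then the opposite sign is excluded at every norm.\<close>

definition admissible :: "bool \<Rightarrow> symtrop \<Rightarrow> symtrop \<Rightarrow> bool" where
  "admissible b z s \<longleftrightarrow> s \<in> T_signed \<and> (tnorm z < tnorm s \<or> z \<in> T_sgn b \<longrightarrow> s \<in> T_sgn b \<union> {0})"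

lemma admissible_compose: "admissible b z x \<Longrightarrow> admissible b z y \<Longrightarrow> admissible b z (compose x y)"
  by (rule compose_cases)

lemma admissible_scale:
  assumes "admissible b z s" "r \<le> 0"
  shows "admissible b z (TElem SPos r * s)"
proof -
  have "tnorm (TElem SPos r * s) \<le> tnorm s" using assms(2) by (rule tnorm_scale_le)
  then show ?thesis using assms(1) unfolding admissible_def
    by (auto simp: T_sgn_mult intro!: signed_mult)
qed

text \<open>If \<open>w\<close> wins on both sides the results coincide, and if it wins on one side
  only the norms differ. Hence a common left factor creates no new opposite ties.\<close>

lemma opp_tie_compose: "opp_tie (compose w x) (compose w y) \<Longrightarrow> opp_tie x y"
  unfolding compose_def opp_tie_def by (metis order.refl)

text \<open>Keeps finished coordinates finished: a \<open>w\<close> strictly below \<open>z\<close>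
  loses against the larger of \<open>x\<close> and \<open>y\<close>, and \<open>w = z\<close> wins
  against both.\<close>

lemma compose_absorb:
  assumes "compose x y = z" "\<not> opp_tie x y" "tnorm w < tnorm z \<or> w = z"
  shows "compose (compose w x) (compose w y) = z"
proof (cases "w = z")
  case True
  then have "tnorm x \<le> tnorm w" "tnorm y \<le> tnorm w" using assms(1) tnorm_compose[of x y] by auto
  then show ?thesis using True by (simp add: compose_def)
next
  case False
  then have lt: "tnorm w < max (tnorm x) (tnorm y)" using assms(1,3) tnorm_compose[of x y] by auto
  consider "tnorm x < tnorm y" | "tnorm y < tnorm x" | "x = y"
    using assms(2) by (auto simp: opp_tie_def not_less order.order_iff_strict intro: linorder_cases)
  then show ?thesis
  proof cases
    case 1
    then have "tnorm w < tnorm y" using lt by simp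
    then have e: "compose w y = y" "y = z" and "tnorm (compose w x) < tnorm y"
      using 1 assms(1) by (auto simp: compose_def tnorm_compose)
    then show ?thesis unfolding e(1) by (subst compose_def) auto
  next
    case 2
    then have "tnorm w < tnorm x" using lt by simp
    then have e: "compose w x = x" "x = z" and "tnorm (compose w y) < tnorm x"
      using 2 assms(1) by (auto simp: compose_def tnorm_compose)
    then show ?thesis unfolding e(1) by (subst compose_def) auto
  next
    case 3
    then show ?thesis using lt assms(1) by (auto simp: compose_def)
  qed
qed

text \<open>Invariant of two vectors whose \<open>k\<close>-th entries tie with opposite signs above \<open>z k\<close>: it
  survives composing both with a vector that removes another tie.\<close>

definition tied_pair ::
  "('a \<Rightarrow> symtrop) set \<Rightarrow> 'a set \<Rightarrow> ('a \<Rightarrow> bool) \<Rightarrow> ('a \<Rightarrow> symtrop) \<Rightarrow> 'a \<Rightarrow>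
    ('a \<Rightarrow> symtrop) \<Rightarrow> ('a \<Rightarrow> symtrop) \<Rightarrow> bool" where
  "tied_pair C F b z k u v \<longleftrightarrow> u \<in> C \<and> v \<in> C \<and> opp_tie (u k) (v k) \<and> tnorm (z k) < tnorm (u k) \<and>
     (\<forall>i. i \<noteq> k \<longrightarrow> admissible (b i) (z i) (u i) \<and> admissible (b i) (z i) (v i) \<and>
        tnorm (z i) \<le> max (tnorm (u i)) (tnorm (v i))) \<and>
     (\<forall>i\<in>F. compose (u i) (v i) = z i \<and> \<not> opp_tie (u i) (v i))"

text \<open>Strictly above the norm of \<open>z i\<close>, or if \<open>z i\<close> has the
  prescribed sign, both entries would be zero or of that sign and could not oppose each other. So
  another tie has exactly the norm of \<open>z i\<close>, and the pattern contradicts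
  \<open>z\<close> there.\<close>

lemma tied_pair_tie:
  assumes "tied_pair C F b z k u v" "i \<noteq> k" "opp_tie (u i) (v i)"
  shows "tnorm (u i) = tnorm (z i)" "tnorm (v i) = tnorm (z i)" "z i \<noteq> 0" "z i \<notin> T_sgn (b i)"
proof -
  have q: "admissible (b i) (z i) (u i)" "admissible (b i) (z i) (v i)" "tnorm (z i) \<le> tnorm (u i)"
    "tnorm (u i) = tnorm (v i)"
    using assms by (auto simp: tied_pair_def opp_tie_def)
  have no: "\<not> (u i \<in> T_sgn (b i) \<union> {0} \<and> v i \<in> T_sgn (b i) \<union> {0})"
    using assms(3) T_sgn_opp_tie by blast
  show e: "tnorm (u i) = tnorm (z i)" "z i \<notin> T_sgn (b i)"
    using q no by (auto simp: admissible_def order.order_iff_strict)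
  then show "tnorm (v i) = tnorm (z i)" using q by simp
  show "z i \<noteq> 0"
  proof
    assume "z i = 0"
    then have "u i = 0" "v i = 0" using e q(4) tnorm_eq_minus_infinity by (metis tnorm_simps(2))+
    then show False using no by simp
  qed
qed

text \<open>Induction on the number of opposite ties away from \<open>k\<close>. A vector
  \<open>w\<close> with \<open>w j = z j\<close> removes the tie at \<open>j\<close> and is too
  small at \<open>k\<close> to disturb the tie there. Once the tie at \<open>k\<close> is the only
  one, that coordinate is filled with \<open>z k\<close>.\<close>

lemma tied_pair_resolve:
  fixes z :: "'a::finite \<Rightarrow> symtrop"
  assumes C: "TC_cone C" and z: "\<And>i. z i \<in> T_signed"
    and w: "\<And>j. j \<noteq> k \<Longrightarrow> z j \<noteq> 0 \<Longrightarrow> z j \<notin> T_sgn (b j) \<Longrightarrow>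
      \<exists>w\<in>C. w j = z j \<and> tnorm (w k) \<le> tnorm (z k) \<and> (\<forall>i. i \<noteq> k \<longrightarrow> admissible (b i) (z i) (w i)) \<and>
        (\<forall>i\<in>F. tnorm (w i) < tnorm (z i) \<or> w i = z i)"
    and uv: "tied_pair C F b z k u v"
  shows "\<exists>s\<in>C. s k = z k \<and> (\<forall>i. i \<noteq> k \<longrightarrow> admissible (b i) (z i) (s i) \<and> tnorm (z i) \<le> tnorm (s i)) \<and>
      (\<forall>i\<in>F. s i = z i)"
  using uv
proof (induction "card {i. i \<noteq> k \<and> opp_tie (u i) (v i)}" arbitrary: u v rule: less_induct)
  case less
  note uv = less.prems
  then have uv': "u \<in> C" "v \<in> C" "opp_tie (u k) (v k)" "tnorm (z k) < tnorm (u k)"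
    "\<And>i. i \<noteq> k \<Longrightarrow> admissible (b i) (z i) (u i)" "\<And>i. i \<noteq> k \<Longrightarrow> admissible (b i) (z i) (v i)"
    "\<And>i. i \<noteq> k \<Longrightarrow> tnorm (z i) \<le> max (tnorm (u i)) (tnorm (v i))"
    "\<And>i. i \<in> F \<Longrightarrow> compose (u i) (v i) = z i" "\<And>i. i \<in> F \<Longrightarrow> \<not> opp_tie (u i) (v i)"
    by (auto simp: tied_pair_def)
  have kF: "k \<notin> F" using uv'(3,9) by blast
  show ?case
  proof (cases "\<exists>j. j \<noteq> k \<and> opp_tie (u j) (v j)")
    case False
    let ?s = "(\<lambda>i. compose (u i) (v i))(k := z k)"
    have "?s \<in> C" using False uv'(4) z by (intro TC_coneD(4)[OF C uv'(1-3)]) auto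
    moreover have "\<forall>i. i \<noteq> k \<longrightarrow> admissible (b i) (z i) (?s i) \<and> tnorm (z i) \<le> tnorm (?s i)"
      using uv' by (auto simp: tnorm_compose intro: admissible_compose)
    moreover have "\<forall>i\<in>F. ?s i = z i" using uv' kF by auto
    ultimately show ?thesis by (intro bexI[of _ ?s]) auto
  next
    case True
    then obtain j where j: "j \<noteq> k" "opp_tie (u j) (v j)" by blast
    note tj = tied_pair_tie[OF uv j]
    obtain w where w: "w \<in> C" "w j = z j" "tnorm (w k) \<le> tnorm (z k)"
      "\<And>i. i \<noteq> k \<Longrightarrow> admissible (b i) (z i) (w i)" "\<And>i. i \<in> F \<Longrightarrow> tnorm (w i) < tnorm (z i) \<or> w i = z i"
      using assms(3)[OF j(1) tj(3,4)] by blast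
    \<comment> \<open>At \<open>j\<close> the vector \<open>w\<close> has the common norm of
      \<open>u j\<close> and \<open>v j\<close>, so on the left it replaces both by
      \<open>z j\<close>.\<close>
    define u' where "u' i = compose (w i) (u i)" for i
    define v' where "v' i = compose (w i) (v i)" for i
    have tie: "opp_tie (u' i) (v' i) \<Longrightarrow> opp_tie (u i) (v i)" for i
      unfolding u'_def v'_def by (rule opp_tie_compose)
    have ntj: "\<not> opp_tie (u' j) (v' j)" using w(2) tj by (simp add: u'_def v'_def compose_def opp_tie_def)
    have k_eq: "u' k = u k" "v' k = v k"
      using w(3) uv'(3,4) by (auto simp: u'_def v'_def compose_def opp_tie_def)
    have "tied_pair C F b z k u' v'"
      unfolding tied_pair_def
    proof (intro conjI allI ballI impI)
      show "u' \<in> C" "v' \<in> C" unfolding u'_def v'_def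
        using TC_coneD(3)[OF C w(1) uv'(1)] TC_coneD(3)[OF C w(1) uv'(2)] by simp_all
      show "opp_tie (u' k) (v' k)" "tnorm (z k) < tnorm (u' k)" using uv' k_eq by simp_all
    next
      fix i assume i: "i \<noteq> k"
      show "admissible (b i) (z i) (u' i)" "admissible (b i) (z i) (v' i)"
        using uv'(5,6) w(4) i by (auto simp: u'_def v'_def intro: admissible_compose)
      show "tnorm (z i) \<le> max (tnorm (u' i)) (tnorm (v' i))"
        using uv'(7)[OF i] by (auto simp: u'_def v'_def tnorm_compose le_max_iff_disj)
    next
      fix i assume i: "i \<in> F"
      show "\<not> opp_tie (u' i) (v' i)" using tie uv'(9) i by blast
      show "compose (u' i) (v' i) = z i"
        using compose_absorb[OF uv'(8)[OF i] uv'(9)[OF i] w(5)[OF i]] by (simp add: u'_def v'_def)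
    qed
    moreover have "card {i. i \<noteq> k \<and> opp_tie (u' i) (v' i)} < card {i. i \<noteq> k \<and> opp_tie (u i) (v i)}"
      using tie ntj j by (intro psubset_card_mono) auto
    ultimately show ?thesis using less.hyps by blast
  qed
qed


definition beyond :: "bool \<Rightarrow> symtrop \<Rightarrow> symtrop \<Rightarrow> bool" where
  "beyond b z s \<longleftrightarrow> admissible b z s \<and> tnorm z \<le> tnorm s"

lemma beyond_refl: "z \<in> T_signed \<Longrightarrow> beyond b z z"
  by (simp add: beyond_def admissible_def)

text \<open>The measure counts the coordinates other than \<open>k\<close> where the pattern
  contradicts a nonzero \<open>z\<close>. Prescribing either sign at \<open>k\<close> supplies
  \<open>s\<close> and \<open>t\<close>, which are scaled to an opposite tie at \<open>k\<close> and
  passed to \<open>tied_pair_resolve\<close>; the vectors needed there come from patterns with one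
  contradiction fewer.\<close>

lemma merge_coordinate:
  fixes z :: "'a::finite \<Rightarrow> symtrop"
  assumes C: "TC_cone C" and z: "\<And>i. z i \<in> T_signed"
    and F: "\<And>b. \<exists>s\<in>C. (\<forall>i. beyond (b i) (z i) (s i)) \<and> (\<forall>i\<in>F. s i = z i)"
  shows "\<exists>s\<in>C. (\<forall>i. beyond (b i) (z i) (s i)) \<and> (\<forall>i\<in>insert k F. s i = z i)"
proof (induction "card {j. j \<noteq> k \<and> z j \<noteq> 0 \<and> z j \<notin> T_sgn (b j)}" arbitrary: b rule: less_induct)
  case less
  note z_beyond = beyond_refl[OF z]
  have finish: ?case if "s \<in> C" "\<forall>i. i \<noteq> k \<longrightarrow> beyond (b i) (z i) (s i)" "\<forall>i\<in>F. s i = z i" "s k = z k" for s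
    using that z_beyond by (intro bexI[of _ s]) (auto, metis)
  \<comment> \<open>\<open>e\<close> is the sign of \<open>z k\<close>, and arbitrary if
    \<open>z k = 0\<close>.\<close>
  obtain e where e: "z k = 0 \<or> z k \<in> T_sgn e" using signed_cases_T_sgn[OF z] by metis
  obtain s where s: "s \<in> C" "\<And>i. i \<noteq> k \<Longrightarrow> beyond (b i) (z i) (s i)" "beyond (\<not> e) (z k) (s k)" "\<And>i. i \<in> F \<Longrightarrow> s i = z i"
    using F[of "b(k := \<not> e)"] by (auto split: if_splits)
  obtain t where t: "t \<in> C" "\<And>i. i \<noteq> k \<Longrightarrow> beyond (b i) (z i) (t i)" "beyond e (z k) (t k)" "\<And>i. i \<in> F \<Longrightarrow> t i = z i"
    using F[of "b(k := e)"] by (auto split: if_splits)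
  show ?case
  proof (cases "s k = z k \<or> t k = z k")
    case True
    then show ?thesis using finish s t by metis
  next
    case ne: False
    \<comment> \<open>An entry of sign \<open>e\<close> would have to have the norm of
      \<open>z k\<close> and hence equal \<open>z k\<close>, which \<open>ne\<close>
      excludes.\<close>
    have sk: "s k \<in> T_sgn (\<not> e)"
      using TC_coneD(1)[OF C s(1)]
    proof (rule signed_cases_T_sgn[where b = e])
      assume "s k = 0"
      then have "tnorm (z k) = -\<infinity>" using s(3) by (simp add: beyond_def)
      then show ?thesis using \<open>s k = 0\<close> ne by (simp add: tnorm_eq_minus_infinity)
    next
      assume a: "s k \<in> T_sgn e"
      then have "s k \<notin> T_sgn (\<not> e) \<union> {0}" by (auto simp: T_sgn_def T_pos_def T_neg_def split: if_splits)
      then have n: "tnorm (s k) = tnorm (z k)" using s(3) by (auto simp: beyond_def admissible_def order.order_iff_strict)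
      have "z k \<noteq> 0"
      proof
        assume "z k = 0"
        then have "s k = 0" using n by simp
        then show False using \<open>s k \<notin> T_sgn (\<not> e) \<union> {0}\<close> by simp
      qed
      then have "s k = z k" using e a n T_sgn_eqI by blast
      then show ?thesis using ne by simp
    qed
    have tk_lt: "tnorm (z k) < tnorm (t k)" and tk: "t k \<in> T_sgn e"
    proof -
      have "tnorm (t k) \<noteq> tnorm (z k)"
      proof
        assume n: "tnorm (t k) = tnorm (z k)"
        show False
        proof (cases "z k = 0")
          case True
          then have "t k = 0" using n by simp
          then show False using ne True by simp
        next
          case False
          then have z: "z k \<in> T_sgn e" using e by blast
          then have "t k \<in> T_sgn e \<union> {0}" using t(3) by (auto simp: beyond_def admissible_def)
          moreover have "t k \<noteq> 0" using n False by (metis tnorm_eq_minus_infinity)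
          ultimately show False using z n ne T_sgn_eqI by blast
        qed
      qed
      then show l: "tnorm (z k) < tnorm (t k)" using t(3) by (auto simp: beyond_def)
      then show "t k \<in> T_sgn e" using t(3) by (auto simp: beyond_def admissible_def)
    qed
    \<comment> \<open>Scaling by \<open>r \<le> 0\<close> lowers the norm or changes nothing, so
      composing a finished coordinate with its scaled copy gives it back.\<close>
    have sF: "r \<le> 0 \<Longrightarrow> compose (TElem SPos r * z i) (z i) = z i"
      "r \<le> 0 \<Longrightarrow> compose (z i) (TElem SPos r * z i) = z i"
      "r \<le> 0 \<Longrightarrow> \<not> opp_tie (z i) (TElem SPos r * z i)"
      "r \<le> 0 \<Longrightarrow> \<not> opp_tie (TElem SPos r * z i) (z i)" for r i
      using scale_nonpos_cases[of r "z i"] by (auto simp: compose_def opp_tie_def)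
    have adm: "admissible (b i) (z i) (s i)" "tnorm (z i) \<le> tnorm (s i)"
      "admissible (b i) (z i) (t i)" "tnorm (z i) \<le> tnorm (t i)" if "i \<noteq> k" for i
      using s(2) t(2) that by (auto simp: beyond_def)
    show ?thesis
    proof (cases "tnorm (s k) = tnorm (z k)")
      case True
      \<comment> \<open>Here \<open>s k\<close> is the negative of \<open>z k\<close>. Scaling
        \<open>t\<close> down to meet \<open>z k\<close> exactly and placing it on the left wins the
        tie, while \<open>s\<close> supplies the lower bounds on the norms elsewhere.\<close>
      have "z k \<noteq> 0" using True sk by (metis T_sgn_def TElem_mem(5,6) tnorm_eq_minus_infinity)
      then have zk: "z k \<in> T_sgn e" using e by blast
      obtain r where r: "r \<le> 0" "tnorm (TElem SPos r * t k) = tnorm (z k)"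
        using T_sgn_scale_to[OF tk zk less_imp_le[OF tk_lt]] .
      have rk: "TElem SPos r * t k = z k" using r(2) tk zk T_sgn_eqI T_sgn_mult by blast
      let ?u = "\<lambda>i. compose (TElem SPos r * t i) (s i)"
      show ?thesis
      proof (rule finish[of ?u])
        show "?u \<in> C" by (rule TC_coneD(3)[OF C TC_coneD(2)[OF C t(1)] s(1)])
        show "\<forall>i. i \<noteq> k \<longrightarrow> beyond (b i) (z i) (?u i)"
          using s(2) t(2) r(1) by (auto simp: beyond_def tnorm_compose le_max_iff_disj intro!: admissible_compose admissible_scale)
        show "\<forall>i\<in>F. ?u i = z i" using s(4) t(4) sF r(1) by simp
        show "?u k = z k" using rk True by (simp add: compose_def)
      qed
    next
      case False
      then have sk_lt: "tnorm (z k) < tnorm (s k)" using s(3) by (auto simp: beyond_def)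
      have opp: "\<not> (x \<in> T_sgn e \<and> x \<in> T_sgn (\<not> e))" for x
        by (auto simp: T_sgn_def T_pos_def T_neg_def split: if_splits)
      \<comment> \<open>The vector that is larger at \<open>k\<close> is scaled down to a tie; the
        unscaled one provides the lower bounds and the values on \<open>F\<close>.\<close>
      have "\<exists>u v. tied_pair C F b z k u v"
      proof (cases "tnorm (s k) \<le> tnorm (t k)")
        case True
        then obtain r where r: "r \<le> 0" "tnorm (TElem SPos r * t k) = tnorm (s k)"
          using T_sgn_scale_to[OF tk sk] by blast
        have "TElem SPos r * t k \<in> T_sgn e" using tk T_sgn_mult by blast
        then have "opp_tie (s k) (TElem SPos r * t k)" using r(2) sk opp by (auto simp: opp_tie_def)
        then have "tied_pair C F b z k s (\<lambda>i. TElem SPos r * t i)"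
          unfolding tied_pair_def using s t sk_lt r(1) sF TC_coneD(2)[OF C t(1)]
          by (auto simp: le_max_iff_disj adm intro!: admissible_scale)
        then show ?thesis by blast
      next
        case False
        then obtain r where r: "r \<le> 0" "tnorm (TElem SPos r * s k) = tnorm (t k)"
          using T_sgn_scale_to[OF sk tk] by (metis nle_le)
        have "TElem SPos r * s k \<in> T_sgn (\<not> e)" using sk T_sgn_mult by blast
        then have "opp_tie (TElem SPos r * s k) (t k)" using r(2) tk opp by (auto simp: opp_tie_def)
        then have "tied_pair C F b z k (\<lambda>i. TElem SPos r * s i) t"
          unfolding tied_pair_def using s t tk_lt r sF TC_coneD(2)[OF C s(1)]
          by (auto simp: le_max_iff_disj adm intro!: admissible_scale)
        then show ?thesis by blast
      qed
      then obtain u v where uv: "tied_pair C F b z k u v" by blast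
      have w: "\<exists>w\<in>C. w j = z j \<and> tnorm (w k) \<le> tnorm (z k) \<and> (\<forall>i. i \<noteq> k \<longrightarrow> admissible (b i) (z i) (w i)) \<and>
          (\<forall>i\<in>F. tnorm (w i) < tnorm (z i) \<or> w i = z i)"
        if j: "j \<noteq> k" "z j \<noteq> 0" "z j \<notin> T_sgn (b j)" for j
      proof -
        have zj: "z j \<in> T_sgn (\<not> b j)" using j by (cases rule: signed_cases_T_sgn[OF z[of j], where b = "b j"]) auto
        \<comment> \<open>Correcting the pattern at \<open>j\<close> decreases the measure. The
          resulting \<open>w j\<close> has the sign of \<open>z j\<close> and at least its norm, so
          scaling down reaches \<open>z j\<close>; at \<open>k\<close> and on \<open>F\<close> the
          scaled vector stays at or strictly below \<open>z\<close>.\<close>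
        let ?b = "b(j := \<not> b j)"
        have "{i. i \<noteq> k \<and> z i \<noteq> 0 \<and> z i \<notin> T_sgn (?b i)} \<subset> {i. i \<noteq> k \<and> z i \<noteq> 0 \<and> z i \<notin> T_sgn (b i)}"
          using j zj by (auto split: if_splits)
        then have "card {i. i \<noteq> k \<and> z i \<noteq> 0 \<and> z i \<notin> T_sgn (?b i)} < card {i. i \<noteq> k \<and> z i \<noteq> 0 \<and> z i \<notin> T_sgn (b i)}"
          by (intro psubset_card_mono) auto
        from less.hyps[OF this] obtain w where w: "w \<in> C" "\<And>i. beyond (?b i) (z i) (w i)" "w k = z k" "\<And>i. i \<in> F \<Longrightarrow> w i = z i"
          by auto
        have qj: "beyond (\<not> b j) (z j) (w j)" using w(2)[of j] by simp
        then have "w j \<in> T_sgn (\<not> b j) \<union> {0}" "tnorm (z j) \<le> tnorm (w j)" using zj by (auto simp: beyond_def admissible_def)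
        moreover have "w j \<noteq> 0"
        proof
          assume "w j = 0"
          then have "tnorm (z j) = -\<infinity>" using calculation(2) by simp
          then show False using j(2) by (simp add: tnorm_eq_minus_infinity)
        qed
        ultimately have wj: "w j \<in> T_sgn (\<not> b j)" "tnorm (z j) \<le> tnorm (w j)" by auto
        obtain r where r: "r \<le> 0" "tnorm (TElem SPos r * w j) = tnorm (z j)"
          using T_sgn_scale_to[OF wj(1) zj wj(2)] .
        have rj: "TElem SPos r * w j = z j" using r(2) wj zj T_sgn_eqI T_sgn_mult by blast
        have "admissible (b i) (z i) (TElem SPos r * w i)" for i
        proof (cases "i = j")
          case True
          then show ?thesis using rj z_beyond[of "b j" j] by (simp add: beyond_def)
        next
          case False
          then show ?thesis using w(2)[of i] r(1) by (auto simp: beyond_def intro: admissible_scale)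
        qed
        then show ?thesis
          using rj TC_coneD(2)[OF C w(1)] w(3,4) scale_nonpos_cases[OF r(1)] tnorm_scale_le[OF r(1)]
          by (intro bexI[of _ "\<lambda>i. TElem SPos r * w i"]) auto
      qed
      obtain s where "s \<in> C" "s k = z k" "\<forall>i. i \<noteq> k \<longrightarrow> admissible (b i) (z i) (s i) \<and> tnorm (z i) \<le> tnorm (s i)" "\<forall>i\<in>F. s i = z i"
        using tied_pair_resolve[OF C z w uv] by blast
      then show ?thesis by (intro finish[of s]) (auto simp: beyond_def)
    qed
  qed
qed

text \<open>Coordinates are fixed one at a time, but for all sign patterns simultaneously, because
  merging one coordinate uses realisations of several patterns.\<close>

lemma mem_TC_cone_if_beyond:
  fixes z :: "'a::finite \<Rightarrow> symtrop"
  assumes C: "TC_cone C" and z: "\<And>i. z i \<in> T_signed"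
    and "\<And>b. \<exists>s\<in>C. \<forall>i. beyond (b i) (z i) (s i)"
  shows "z \<in> C"
proof -
  have "\<exists>s\<in>C. (\<forall>i. beyond (b i) (z i) (s i)) \<and> (\<forall>i\<in>F. s i = z i)" if "finite F" for F b
    using that
  proof (induction F arbitrary: b rule: finite_induct)
    case empty
    then show ?case using assms(3) by simp
  next
    case (insert k F)
    show ?case by (rule merge_coordinate[OF C z insert.IH])
  qed
  from this[of UNIV "\<lambda>_. True"] obtain s where "s \<in> C" "\<forall>i. s i = z i" by auto
  then show ?thesis by (metis ext)
qed

section \<open>The cone over a TC-convex set\<close>

text \<open>The additional coordinate \<open>None\<close> turns the constant term of a halfspace
  into an ordinary coefficient.\<close>

definition homog :: "symtrop ^ 'd \<Rightarrow> 'd option \<Rightarrow> symtrop" where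
  "homog x k = (case k of None \<Rightarrow> 1 | Some i \<Rightarrow> x $ i)"

lemma homog_simps [simp]: "homog x None = 1" "homog x (Some i) = x $ i"
  by (simp_all add: homog_def)

lemma one_symtrop_mem [simp]: "(1::symtrop) \<in> T_pos" "(1::symtrop) \<in> T_signed"
  by (simp_all add: one_symtrop_def)

lemma homog_signed: "x \<in> signed_vectors \<Longrightarrow> homog x k \<in> T_signed"
  by (cases k) (auto simp: signed_vectors_def)

lemma sum_option: "(\<Sum>k\<in>UNIV. f k) = f None + (\<Sum>i\<in>(UNIV::'d::finite set). f (Some i))"
  by (simp add: UNIV_option_conv sum.reindex)

lemma closed_halfspace_iff:
  assumes "a0 \<in> T_signed" "a \<in> signed_vectors"
  shows "x \<in> closed_halfspace a0 a \<longleftrightarrow> x \<in> signed_vectors \<and>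
    dominant_pos (\<lambda>k. case_option a0 (($) a) k * homog x k) UNIV"
proof (cases "x \<in> signed_vectors")
  case True
  have "case_option a0 (($) a) k * homog x k \<in> T_signed" for k
    using assms homog_signed[OF True, of k] by (cases k) (auto simp: signed_vectors_def intro!: signed_mult)
  then have "dominant_pos (\<lambda>k. case_option a0 (($) a) k * homog x k) UNIV \<longleftrightarrow>
      (\<Sum>k\<in>UNIV. case_option a0 (($) a) k * homog x k) \<in> T_pos \<union> T_balanced"
    by (intro sum_nonneg_iff_dominant_pos[symmetric]) auto
  then show ?thesis using True unfolding closed_halfspace_def sum_option by simp
qed (simp add: closed_halfspace_def)

definition cone_of :: "(symtrop ^ 'd) set \<Rightarrow> ('d option \<Rightarrow> symtrop) set" where
  "cone_of S = {\<lambda>k. TElem SPos r * homog x k | r x. x \<in> S}"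

lemma T_pos_scale: "TElem SPos r * x \<in> T_pos \<longleftrightarrow> x \<in> T_pos"
  using T_sgn_mult[of r x True] by (simp add: T_sgn_def)

lemma dominant_pos_scale:
  "dominant_pos (\<lambda>k. a k * (TElem SPos r * f k)) I \<longleftrightarrow> dominant_pos (\<lambda>k. a k * f k) I"
proof -
  have "a k * (TElem SPos r * f k) = TElem SPos r * (a k * f k)" for k
    by (rule mult.left_commute)
  then show ?thesis by (simp add: dominant_pos_def T_pos_scale tnorm_mult_le_iff)
qed

lemma scale_scale: "TElem SPos r * (TElem SPos q * x) = TElem SPos (r + q) * x"
  by (simp flip: mult.assoc)

lemma scale_zero [simp]: "TElem SPos 0 * x = x"
  by (simp flip: one_symtrop_def)

text \<open>Scaling does not affect dominance, so a vector with positive entry at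
  \<open>None\<close> can be normalised to a homogenized point. This point lies in every halfspace
  that contains \<open>x\<close> and \<open>y\<close>.\<close>

lemma mem_cone_of:
  assumes S: "TC_convex S" and x: "x \<in> S" and y: "y \<in> S"
    and w: "\<And>k. w k \<in> T_signed" "w None = TElem SPos m"
      "\<And>a. dominant_pos (\<lambda>k. a k * (TElem SPos r * homog x k)) UNIV \<Longrightarrow>
         dominant_pos (\<lambda>k. a k * (TElem SPos q * homog y k)) UNIV \<Longrightarrow> dominant_pos (\<lambda>k. a k * w k) UNIV"
  shows "w \<in> cone_of S"
proof -
  define z where "z = (\<chi> i. TElem SPos (- m) * w (Some i))"
  have hz: "homog z k = TElem SPos (- m) * w k" for k
    by (cases k) (simp_all add: z_def w(2) one_symtrop_def)
  have sz: "z \<in> signed_vectors" using w(1) by (simp add: signed_vectors_def z_def signed_mult)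
  have "z \<in> conv_TC2 x y"
    unfolding conv_TC2_def closed_halfspaces_def
    using w(3) sz by (auto simp: closed_halfspace_iff dominant_pos_scale hz)
  then have "z \<in> S" using S x y unfolding TC_convex_def by blast
  moreover have "w = (\<lambda>k. TElem SPos m * homog z k)"
    by (simp add: hz scale_scale)
  ultimately show ?thesis unfolding cone_of_def by blast
qed

lemma TC_cone_cone_of:
  assumes S: "TC_convex S"
  shows "TC_cone (cone_of S)"
  unfolding TC_cone_def
proof (intro conjI ballI allI impI)
  fix u k assume "u \<in> cone_of S"
  then show sg: "u k \<in> T_signed"
    using S by (auto simp: cone_of_def TC_convex_def intro!: signed_mult homog_signed)
next
  fix u r assume "u \<in> cone_of S"
  then show "(\<lambda>k. TElem SPos r * u k) \<in> cone_of S"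
    unfolding cone_of_def by (force simp: scale_scale)
next
  fix u v assume "u \<in> cone_of S" "v \<in> cone_of S"
  then obtain r x q y where x: "x \<in> S" "u = (\<lambda>k. TElem SPos r * homog x k)"
    and y: "y \<in> S" "v = (\<lambda>k. TElem SPos q * homog y k)" by (auto simp: cone_of_def)
  have sg: "u k \<in> T_signed" "v k \<in> T_signed" for k
    using S x y by (auto simp: TC_convex_def intro!: signed_mult homog_signed)
  have None: "compose (u None) (v None) = TElem SPos (max r q)" by (auto simp: x y compose_def max_def)
  show "(\<lambda>k. compose (u k) (v k)) \<in> cone_of S"
  proof (rule mem_cone_of[OF S x(1) y(1), where r = r and q = q and m = "max r q"])
    show "compose (u k) (v k) \<in> T_signed" for k using sg by (rule compose_cases)
  qed (use None in \<open>simp_all add: dominant_pos_compose x(2) y(2)\<close>)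
  fix k w
  assume k: "opp_tie (u k) (v k)" "\<forall>i. i \<noteq> k \<longrightarrow> \<not> opp_tie (u i) (v i)"
    and w: "w \<in> T_signed" "tnorm w \<le> tnorm (u k)"
  let ?w = "(\<lambda>i. compose (u i) (v i))(k := w)"
  \<comment> \<open>Homogenizing entries are positive and hence never opposed; so filling leaves
    \<open>None\<close> intact.\<close>
  have kN: "k \<noteq> None"
  proof
    assume "k = None"
    then show False using k(1) by (simp add: x y opp_tie_def)
  qed
  show "?w \<in> cone_of S"
  proof (rule mem_cone_of[OF S x(1) y(1), where r = r and q = q and m = "max r q"])
    show "?w i \<in> T_signed" for i using sg[of i] w(1) by (auto intro: compose_cases)
    show "?w None = TElem SPos (max r q)" using kN None by auto
    fix a
    assume "dominant_pos (\<lambda>k. a k * (TElem SPos r * homog x k)) UNIV"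
      "dominant_pos (\<lambda>k. a k * (TElem SPos q * homog y k)) UNIV"
    then have "dominant_pos (\<lambda>k. a k * u k) UNIV" "dominant_pos (\<lambda>k. a k * v k) UNIV" by (simp_all add: x y)
    then show "dominant_pos (\<lambda>i. a i * ?w i) UNIV"
      by (rule dominant_pos_fill[where k = k and w = ?w]) (use sg k w in auto)
  qed
qed

section \<open>Choosing a composition order\<close>

definition argmax_norm :: "('i \<Rightarrow> 'a \<Rightarrow> symtrop) \<Rightarrow> 'i set \<Rightarrow> 'a \<Rightarrow> 'i set" where
  "argmax_norm y I k = {i\<in>I. \<forall>j\<in>I. tnorm (y j k) \<le> tnorm (y i k)}"

lemma argmax_norm_nonempty:
  assumes "finite I" "I \<noteq> {}"
  shows "argmax_norm y I k \<noteq> {}"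
proof -
  have "Max ((\<lambda>i. tnorm (y i k)) ` I) \<in> (\<lambda>i. tnorm (y i k)) ` I" using assms by (intro Max_in) auto
  then obtain i where "i \<in> I" "tnorm (y i k) = Max ((\<lambda>i. tnorm (y i k)) ` I)" by auto
  then have "i \<in> argmax_norm y I k" using assms by (simp add: argmax_norm_def)
  then show ?thesis by blast
qed

lemma argmax_norm_remove:
  assumes "finite I" "i \<in> I" "i \<notin> argmax_norm y I k"
  shows "argmax_norm y (I - {i}) k = argmax_norm y I k"
proof -
  obtain m where m: "m \<in> argmax_norm y I k" using argmax_norm_nonempty[OF assms(1), of y k] assms(2) by auto
  then have "m \<noteq> i" using assms by blast
  then show ?thesis using m assms(2,3) unfolding argmax_norm_def by (auto intro: order.trans)
qed

text \<open>If the first index of a composition order is drawn with probability proportional to the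
  weights, the expected value of the sum in the last assumption does not change; hence some first
  index does not increase it.\<close>

lemma greedy_composition:
  fixes y :: "'i \<Rightarrow> 'a::finite \<Rightarrow> symtrop" and c :: "'i \<Rightarrow> real"
  assumes C: "TC_cone C" and "finite I" "I \<noteq> {}" "\<And>i. i \<in> I \<Longrightarrow> y i \<in> C" "\<And>i. i \<in> I \<Longrightarrow> 0 < c i"
    and "(\<Sum>k\<in>K. sum c (argmax_norm y I k \<inter> Bad k) / sum c (argmax_norm y I k)) < 1"
  shows "\<exists>s\<in>C. \<forall>k. \<exists>i\<in>argmax_norm y I k. s k = y i k \<and> (k \<in> K \<longrightarrow> i \<notin> Bad k)"
  using assms(2-)
proof (induction "card I" arbitrary: I K rule: less_induct)
  case less
  note fin = less.prems(1) and ne = less.prems(2) and y = less.prems(3) and c = less.prems(4)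
  let ?G = "argmax_norm y I"
  define f where "f k = sum c (?G k \<inter> Bad k) / sum c (?G k)" for k
  have GI: "?G k \<subseteq> I" for k by (auto simp: argmax_norm_def)
  have finG: "finite (?G k)" for k using GI fin by (rule finite_subset)
  have g: "0 < sum c (?G k)" for k
    using finG argmax_norm_nonempty[OF fin ne, of y k] GI[of k] c by (intro sum_pos) auto
  have f0: "0 \<le> f k" for k
    unfolding f_def using GI c g by (intro divide_nonneg_pos sum_nonneg) (auto intro: less_imp_le)
  \<comment> \<open>\<open>p i k\<close> is the bad share at \<open>k\<close> once \<open>i\<close>
    has been drawn: a maximiser settles it to 0 or 1, any other index leaves it unchanged by
    \<open>argmax_norm_remove\<close>. Its weighted mean is \<open>f k\<close>.\<close>
  define p where "p i k = (if i \<in> ?G k then of_bool (i \<in> Bad k) else f k)" for i k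
  have p0: "0 \<le> p i k" for i k using f0 by (simp add: p_def)
  have pk: "(\<Sum>i\<in>I. c i * p i k) = sum c I * f k" for k
  proof -
    have "(\<Sum>i\<in>I. c i * p i k) = (\<Sum>i\<in>?G k. c i * p i k) + (\<Sum>i\<in>I - ?G k. c i * p i k)"
      using sum.subset_diff[OF GI fin] by (simp add: add.commute)
    also have "(\<Sum>i\<in>?G k. c i * p i k) = (\<Sum>i\<in>?G k. if i \<in> Bad k then c i else 0)"
      by (rule sum.cong) (auto simp: p_def)
    also have "\<dots> = sum c (?G k \<inter> Bad k)" using finG by (simp add: sum.inter_restrict)
    also have "\<dots> = sum c (?G k) * f k" using g[of k] by (simp add: f_def)
    also have "(\<Sum>i\<in>I - ?G k. c i * p i k) = sum c (I - ?G k) * f k"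
      by (simp add: p_def sum_distrib_right)
    finally show ?thesis using sum.subset_diff[OF GI fin, of c k] by (simp add: algebra_simps)
  qed
  have "\<exists>i\<in>I. (\<Sum>k\<in>K. p i k) < 1"
  proof (rule ccontr)
    assume "\<not> ?thesis"
    then have "sum c I \<le> (\<Sum>i\<in>I. c i * (\<Sum>k\<in>K. p i k))"
      using c by (intro sum_mono) (auto simp: not_less)
    also have "\<dots> = (\<Sum>k\<in>K. \<Sum>i\<in>I. c i * p i k)"
      by (simp add: sum_distrib_left sum.swap[of _ I K])
    also have "\<dots> = sum c I * (\<Sum>k\<in>K. f k)" by (simp add: pk sum_distrib_left)
    finally have "1 \<le> (\<Sum>k\<in>K. f k)" using sum_pos[OF fin ne, of c] c by simp
    then show False using less.prems(5) by (simp add: f_def)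
  qed
  then obtain i where i: "i \<in> I" "(\<Sum>k\<in>K. p i k) < 1" by blast
  \<comment> \<open>A single coordinate of \<open>K\<close> settled badly would already contribute
    1.\<close>
  have good: "i \<notin> Bad k" if "k \<in> K" "i \<in> ?G k" for k
  proof
    assume "i \<in> Bad k"
    then have "p i k = 1" using that by (simp add: p_def)
    moreover have "p i k \<le> (\<Sum>k\<in>K. p i k)" using that p0 by (intro member_le_sum) auto
    ultimately show False using i by simp
  qed
  show ?case
  proof (cases "I = {i}")
    case True
    then have "?G k = {i}" for k by (auto simp: argmax_norm_def)
    then show ?thesis using y[OF i(1)] good by (intro bexI[of _ "y i"]) auto
  next
    case False
    let ?I = "I - {i}" and ?K = "{k\<in>K. i \<notin> ?G k}"
    note rem = argmax_norm_remove[OF fin i(1)]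
    have "(\<Sum>k\<in>?K. sum c (argmax_norm y ?I k \<inter> Bad k) / sum c (argmax_norm y ?I k)) = (\<Sum>k\<in>?K. p i k)"
      by (rule sum.cong) (auto simp: rem p_def f_def)
    also have "\<dots> \<le> (\<Sum>k\<in>K. p i k)" using p0 by (intro sum_mono2) auto
    finally have "(\<Sum>k\<in>?K. sum c (argmax_norm y ?I k \<inter> Bad k) / sum c (argmax_norm y ?I k)) < 1"
      using i(2) by simp
    moreover have "card ?I < card I" using i fin by (intro psubset_card_mono) auto
    ultimately obtain s where s: "s \<in> C" "\<And>k. \<exists>j\<in>argmax_norm y ?I k. s k = y j k \<and> (k \<in> ?K \<longrightarrow> j \<notin> Bad k)"
      using less.hyps[of ?I ?K] False i(1) fin y c by auto
    \<comment> \<open>Where \<open>i\<close> is a maximiser the left bias keeps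
      \<open>y i k\<close>; elsewhere the entry from the remaining indices is strictly
      larger.\<close>
    let ?s = "\<lambda>k. compose (y i k) (s k)"
    have "\<exists>j\<in>?G k. ?s k = y j k \<and> (k \<in> K \<longrightarrow> j \<notin> Bad k)" for k
    proof (cases "i \<in> ?G k")
      case True
      obtain j where "j \<in> I" "s k = y j k" using s(2)[of k] by (auto simp: argmax_norm_def)
      then have "?s k = y i k" using True by (auto simp: argmax_norm_def compose_def)
      then show ?thesis using True good by blast
    next
      case False
      obtain j where j: "j \<in> ?G k" "s k = y j k" "k \<in> ?K \<longrightarrow> j \<notin> Bad k" using s(2)[of k] by (auto simp: rem[OF False])
      have "\<not> tnorm (s k) \<le> tnorm (y i k)" using False j i(1) by (auto simp: argmax_norm_def intro: order.trans)
      then show ?thesis using j False by (auto simp: compose_def)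
    qed
    then show ?thesis using TC_coneD(3)[OF C y[OF i(1)] s(1)] by (intro bexI[of _ ?s]) auto
  qed
qed

section \<open>Signed valuation\<close>

lemma sval_simps [simp]: "sval 0 = 0" "sval f = 0 \<longleftrightarrow> f = 0" "sval f \<in> T_signed"
  by (simp_all add: sval_def)

lemma sval_vec_nth [simp]: "sval_vec v $ i = sval (v $ i)"
  by (simp add: sval_vec_def)

text \<open>Turns bounds on the valuation into vanishing coefficients, the zero series included, so
  that sums can be treated coefficientwise.\<close>

lemma tnorm_sval_le_iff: "tnorm (sval f) \<le> ereal r \<longleftrightarrow> (\<forall>b>r. pcoeff f b = 0)"
proof (cases "f = 0")
  case False
  have "lead_exp f \<le> r \<longleftrightarrow> (\<forall>b>r. pcoeff f b = 0)"
    using lead_exp[OF False] by (meson dual_order.strict_trans1 not_less)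
  then show ?thesis using False by (simp add: sval_def)
qed simp

lemma lead_exp_eq_if_bounded: "tnorm (sval f) \<le> ereal r \<Longrightarrow> pcoeff f r \<noteq> 0 \<Longrightarrow> lead_exp f = r"
  by (intro lead_exp_eqI) (auto simp: tnorm_sval_le_iff)

lemma sval_eq_pos_iff: "sval f = TElem SPos r \<longleftrightarrow> 0 < pcoeff f r \<and> tnorm (sval f) \<le> ereal r"
  (is "?l \<longleftrightarrow> ?r")
proof
  assume l: ?l
  then have "f \<noteq> 0" "0 < f" "lead_exp f = r" by (auto simp: sval_def split: if_splits)
  then show ?r using l by (auto simp: puiseux_pos_iff)
next
  assume r: ?r
  then have "f \<noteq> 0" "lead_exp f = r" using lead_exp_eq_if_bounded[of f r] by auto
  then show ?l using r by (auto simp: sval_def puiseux_pos_iff)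
qed

lemma sval_eq_neg_iff: "sval f = TElem SNeg r \<longleftrightarrow> pcoeff f r < 0 \<and> tnorm (sval f) \<le> ereal r"
  (is "?l \<longleftrightarrow> ?r")
proof
  assume l: ?l
  then have *: "f \<noteq> 0" "\<not> 0 < f" "lead_exp f = r" by (auto simp: sval_def split: if_splits)
  then show ?r using l lead_exp(1)[OF *(1)] by (auto simp: puiseux_pos_iff)
next
  assume r: ?r
  then have "f \<noteq> 0" "lead_exp f = r" using lead_exp_eq_if_bounded[of f r] by auto
  then show ?l using r by (auto simp: sval_def puiseux_pos_iff)
qed

lemma sval_mult: "sval (f * g) = sval f * sval g"
proof (cases "f = 0 \<or> g = 0")
  case False
  note f = lead_exp[of f] and g = lead_exp[of g]
  have t: "pcoeff (f * g) (lead_exp f + lead_exp g) = pcoeff f (lead_exp f) * pcoeff g (lead_exp g)"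
    "lead_exp f + lead_exp g < r \<Longrightarrow> pcoeff (f * g) r = 0" for r
    using pcoeff_times_top[OF f(2) g(2)] False by auto
  have "lead_exp (f * g) = lead_exp f + lead_exp g"
    using t f(1) g(1) False by (intro lead_exp_eqI) auto
  then show ?thesis using False by (auto simp: sval_def zero_less_mult_iff)
qed auto

lemma sval_one [simp]: "sval 1 = 1"
  unfolding one_symtrop_def by (simp add: sval_eq_pos_iff pcoeff_one tnorm_sval_le_iff)

lemma sval_pmonom: "sval (pmonom c r) = (if c = 0 then 0 else if c > 0 then TElem SPos r else TElem SNeg r)"
proof -
  have "pmonom c r = 0 \<longleftrightarrow> c = 0"
    by (metis pcoeff_zero pmonom.rep_eq puiseux_eqI)
  moreover have "tnorm (sval (pmonom c r)) \<le> ereal r" by (simp add: tnorm_sval_le_iff pmonom.rep_eq)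
  ultimately show ?thesis
    using sval_eq_pos_iff[of "pmonom c r" r] sval_eq_neg_iff[of "pmonom c r" r] by (auto simp: pmonom.rep_eq)
qed

lemma of_nat_pmonom: "of_nat n * pmonom c r = pmonom (of_nat n * c) r"
proof (induction n)
  case 0
  show ?case by (rule puiseux_eqI) (simp add: pmonom.rep_eq)
next
  case (Suc n)
  then show ?case by (intro puiseux_eqI) (simp add: distrib_right pmonom.rep_eq)
qed

lemma uminus_pmonom: "- pmonom c r = pmonom (- c) r"
  by (rule puiseux_eqI) (simp add: pmonom.rep_eq)

lemma lift_J_entry:
  fixes x :: "symtrop ^ 'd"
  shows "x $ i = 0 \<Longrightarrow> lift_J J x $ i = 0"
    and "x $ i = TElem SPos r \<Longrightarrow> lift_J J x $ i = pmonom (if i \<in> J then of_nat (CARD('d) + 1) else 1) r"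
    and "x $ i = TElem SNeg r \<Longrightarrow> lift_J J x $ i = pmonom (if i \<in> J then - 1 else - of_nat (CARD('d) + 1)) r"
  unfolding lift_J_def by (simp_all add: zero_symtrop_def of_nat_pmonom uminus_pmonom del: of_nat_add of_nat_Suc)

lemma sval_vec_lift_J:
  assumes "x \<in> signed_vectors"
  shows "sval_vec (lift_J J x) = x"
proof -
  have "sval (lift_J J x $ i) = x $ i" for i
  proof -
    have "x $ i \<in> T_signed" using assms by (simp add: signed_vectors_def)
    then consider "x $ i = 0" | r where "x $ i = TElem SPos r" | r where "x $ i = TElem SNeg r"
      by (auto simp: signed_iff T_pos_def T_neg_def)
    then show ?thesis
    proof cases
    qed (auto simp: lift_J_entry sval_pmonom)
  qed
  then show ?thesis by (simp add: sval_vec_def vec_eq_iff)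
qed

section \<open>Convex combinations over an ordered field\<close>

lemma vec_convex_hull: "vec_convex (vec_convex hull A)"
  by (rule hull_in) (auto simp: vec_convex_def)

lemma vec_convex_hull_combination:
  fixes X :: "'i \<Rightarrow> 'a::linordered_field ^ 'd"
  assumes "finite I" "Z \<in> vec_convex hull (X ` I)"
  obtains l where "\<And>i. i \<in> I \<Longrightarrow> 0 \<le> l i" "sum l I = 1" "Z = (\<Sum>i\<in>I. l i *s X i)"
proof -
  define S where "S = {\<Sum>i\<in>I. l i *s X i | l. (\<forall>i\<in>I. 0 \<le> l i) \<and> sum l I = 1}"
  have "X j \<in> S" if "j \<in> I" for j
  proof -
    have "(\<Sum>i\<in>I. (if i = j then 1 else 0) *s X i) = (\<Sum>i\<in>I. if i = j then X i else 0)"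
      by (rule sum.cong) auto
    also have "\<dots> = X j" using assms(1) that by simp
    finally show ?thesis
      unfolding S_def using assms(1) that
      by (intro CollectI exI[of _ "\<lambda>i. if i = j then 1 else 0"]) auto
  qed
  moreover have "vec_convex S"
    unfolding vec_convex_def
  proof (intro ballI allI impI)
    fix x y u v assume x: "x \<in> S" and y: "y \<in> S" and uv: "0 \<le> u" "0 \<le> v" "u + v = (1::'a)"
    obtain l m where l: "x = (\<Sum>i\<in>I. l i *s X i)" "\<forall>i\<in>I. 0 \<le> l i" "sum l I = 1"
      and m: "y = (\<Sum>i\<in>I. m i *s X i)" "\<forall>i\<in>I. 0 \<le> m i" "sum m I = 1"
      using x y unfolding S_def by auto
    have "u *s x + v *s y = (\<Sum>i\<in>I. (u * l i + v * m i) *s X i)"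
      unfolding l m by (simp add: vec_eq_iff sum_distrib_left sum.distrib algebra_simps)
    moreover have "(\<Sum>i\<in>I. u * l i + v * m i) = 1"
      using l m uv by (simp add: sum.distrib flip: sum_distrib_left)
    ultimately show "u *s x + v *s y \<in> S"
      unfolding S_def using l m uv by (intro CollectI exI[of _ "\<lambda>i. u * l i + v * m i"]) auto
  qed
  ultimately have "vec_convex hull (X ` I) \<subseteq> S" by (intro hull_minimal) auto
  then show ?thesis using assms(2) that unfolding S_def by blast
qed

section \<open>Points of the cone from lifted hulls\<close>

lemma tnorm_sum_le:
  assumes "finite I" "\<And>i. i \<in> I \<Longrightarrow> tnorm (sval (f i)) \<le> N"
  shows "tnorm (sval (sum f I)) \<le> N"
proof (cases N)
  case (real r)
  then show ?thesis using assms by (simp add: tnorm_sval_le_iff)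
next
  case MInf
  then have "\<And>i. i \<in> I \<Longrightarrow> f i = 0" using assms(2) by simp
  then show ?thesis by simp
qed simp

lemma pcoeff_eq_0_if_tnorm_less:
  assumes "tnorm (sval f) < ereal N"
  shows "pcoeff f N = 0"
proof -
  obtain q where "q < N" "tnorm (sval f) \<le> ereal q"
    using assms by (cases "sval f") (auto intro: that[of "N - 1"])
  then show ?thesis by (simp add: tnorm_sval_le_iff)
qed

text \<open>The lift gives entries against the pattern \<open>b\<close> the factor
  \<open>d + 1\<close> and the others the factor 1. Where a sign is prescribed, the top coefficient
  of the combination must not have the wrong sign, so the bad indices carry at most
  \<open>1 / (d + 2)\<close> of the weight. Summed over at most \<open>d\<close> coordinates this
  stays below 1, and \<open>greedy_composition\<close> applies.\<close>

lemma ex_beyond_if_mem_lifted_hull: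
  fixes x :: "nat \<Rightarrow> symtrop ^ 'd" and b :: "'d option \<Rightarrow> bool"
  assumes S: "TC_convex S" and "finite I" and x: "\<And>i. i \<in> I \<Longrightarrow> x i \<in> S"
    and Z: "Z \<in> vec_convex hull ((\<lambda>i. lift_J {j. \<not> b (Some j)} (x i)) ` I)"
  shows "\<exists>s\<in>cone_of S. \<forall>k. beyond (b k) (homog (sval_vec Z) k) (s k)"
proof -
  let ?d = "real CARD('d)"
  define X where "X i = lift_J {j. \<not> b (Some j)} (x i)" for i
  obtain l where l: "\<And>i. i \<in> I \<Longrightarrow> 0 \<le> l i" "sum l I = 1" "Z = (\<Sum>i\<in>I. l i *s X i)"
    using vec_convex_hull_combination[OF \<open>finite I\<close> Z] unfolding X_def by blast
  \<comment> \<open>Without zero weights, all leading coefficients \<open>c i\<close> are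
    positive.\<close>
  define I' where "I' = {i\<in>I. l i \<noteq> 0}"
  have fin: "finite I'" and I': "I' \<subseteq> I" using \<open>finite I\<close> by (auto simp: I'_def)
  have l_pos: "0 < l i" if "i \<in> I'" for i using l(1)[of i] that by (auto simp: I'_def)
  have sum_l: "sum l I' = 1" using l(2) \<open>finite I\<close> sum.mono_neutral_right[OF \<open>finite I\<close> I', of l] by (auto simp: I'_def)
  have ne: "I' \<noteq> {}" using sum_l by auto
  define c where "c i = pcoeff (l i) (lead_exp (l i))" for i
  have c: "0 < c i" if "i \<in> I'" for i using l_pos[OF that] by (simp add: c_def puiseux_pos_iff)
  define H where "H i k = (case k of None \<Rightarrow> 1 | Some j \<Rightarrow> X i $ j)" for i k
  define HZ where "HZ k = (case k of None \<Rightarrow> 1 | Some j \<Rightarrow> Z $ j)" for k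
  have HZ: "HZ k = (\<Sum>i\<in>I'. l i * H i k)" for k
  proof (cases k)
    case None
    then show ?thesis using sum_l by (simp add: HZ_def H_def)
  next
    case (Some j)
    have "(\<Sum>i\<in>I. l i * X i $ j) = (\<Sum>i\<in>I'. l i * X i $ j)"
      by (rule sum.mono_neutral_right[OF \<open>finite I\<close> I']) (auto simp: I'_def)
    then show ?thesis using Some l(3) by (simp add: HZ_def H_def)
  qed
  define z where "z = homog (sval_vec Z)"
  have z: "z k = sval (HZ k)" for k by (cases k) (simp_all add: z_def HZ_def sval_vec_def)
  have sx: "x i \<in> signed_vectors" if "i \<in> I" for i using S x[OF that] by (auto simp: TC_convex_def)
  define y where "y i k = TElem SPos (lead_exp (l i)) * homog (x i) k" for i k
  have y: "y i k = sval (l i * H i k)" if "i \<in> I'" for i k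
  proof -
    have "sval (l i) = TElem SPos (lead_exp (l i))" using l_pos[OF that] by (simp add: sval_def)
    moreover have "sval (H i k) = homog (x i) k"
    proof (cases k)
      case (Some j)
      have "sval_vec (X i) = x i" unfolding X_def using sx that I' by (intro sval_vec_lift_J) auto
      then have "sval (X i $ j) = x i $ j" by (metis sval_vec_def vec_lambda_beta)
      then show ?thesis using Some by (simp add: H_def)
    qed (simp add: H_def)
    ultimately show ?thesis by (simp add: y_def sval_mult)
  qed
  let ?G = "argmax_norm y I'"
  have finG: "finite (?G k)" for k using fin by (simp add: argmax_norm_def)
  have G_le: "tnorm (y i k) \<le> tnorm (y j k)" if "j \<in> ?G k" "i \<in> I'" for i j k
    using that by (simp add: argmax_norm_def)
  have GI: "?G k \<subseteq> I'" for k by (auto simp: argmax_norm_def)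
  have z_le: "tnorm (z k) \<le> tnorm (y i k)" if "i \<in> ?G k" for i k
    unfolding z HZ by (rule tnorm_sum_le[OF fin]) (use G_le[OF that] y in auto)
  have coeff: "pcoeff (HZ k) N = (\<Sum>i\<in>?G k. pcoeff (l i * H i k) N)"
    if "m \<in> ?G k" "tnorm (y m k) = ereal N" for m k N
    unfolding HZ pcoeff_sum
  proof (rule sum.mono_neutral_right[OF fin GI], intro ballI)
    fix i assume i: "i \<in> I' - ?G k"
    then obtain j where j: "j \<in> I'" "tnorm (y i k) < tnorm (y j k)" by (auto simp: argmax_norm_def not_le)
    then have "tnorm (y i k) < ereal N" using G_le[OF that(1) j(1)] that(2) by simp
    then show "pcoeff (l i * H i k) N = 0" using i y pcoeff_eq_0_if_tnorm_less by simp
  qed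
  have lc: "pcoeff (l i * pmonom a q) (lead_exp (l i) + q) = c i * a" if "i \<in> I'" for i a q
    using pcoeff_times_top(1)[of "lead_exp (l i)" "l i" q "pmonom a q"] lead_exp(2)[of "l i"] l_pos[OF that]
    by (auto simp: c_def pmonom.rep_eq)
  define Bad where "Bad k = {i. y i k \<notin> T_sgn (b k)}" for k
  \<comment> \<open>The coordinates where admissibility restricts a nonzero entry of top norm.
    \<open>None\<close> is left out and treated separately.\<close>
  define K where "K = {k. k \<noteq> None \<and> (\<exists>i\<in>?G k. y i k \<noteq> 0 \<and> (tnorm (z k) < tnorm (y i k) \<or> z k \<in> T_sgn (b k)))}"
  have ratio: "sum c (?G k \<inter> Bad k) / sum c (?G k) \<le> 1 / (?d + 2)" if "k \<in> K" for k
  proof -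
    obtain j m where k: "k = Some j" and m: "m \<in> ?G k" "y m k \<noteq> 0"
      and cond: "tnorm (z k) < tnorm (y m k) \<or> z k \<in> T_sgn (b k)"
      using \<open>k \<in> K\<close> unfolding K_def by blast
    obtain N where N: "tnorm (y m k) = ereal N" using m(2) by (cases "y m k") (auto simp: zero_symtrop_def)
    define e where "e = (if b k then 1 else - 1 :: real)"
    have tm: "e * pcoeff (l i * H i k) N = (if i \<in> Bad k then - ((?d + 1) * c i) else c i)" if i: "i \<in> ?G k" for i
    proof -
      have iI: "i \<in> I'" using i GI by blast
      have yi: "tnorm (y i k) = ereal N"
        using N G_le[OF i, of m] G_le[OF m(1) iI] m(1) GI[of k] by auto
      then obtain t q where t: "x i $ j = TElem t q" "y i k = TElem t N" "N = lead_exp (l i) + q"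
        by (cases "x i $ j") (auto simp: y_def k)
      have "t \<noteq> SBal" using y[OF iI, of k] t(2) sval_simps(3) by (metis TElem_mem(4))
      then consider "t = SPos" | "t = SNeg" by (cases t) auto
      then show ?thesis
      proof cases
        case 1
        then have "H i k = pmonom (if b k then 1 else ?d + 1) q"
          using lift_J_entry(2)[of "x i" j q] t(1) by (auto simp: H_def k X_def add.commute)
        then show ?thesis using lc[OF iI] t 1 by (simp add: e_def Bad_def T_sgn_def)
      next
        case 2
        then have "H i k = pmonom (if b k then - (?d + 1) else - 1) q"
          using lift_J_entry(3)[of "x i" j q] t(1) by (auto simp: H_def k X_def add.commute)
        then show ?thesis using lc[OF iI] t 2 by (simp add: e_def Bad_def T_sgn_def algebra_simps)
      qed
    qed
    \<comment> \<open>If \<open>z k\<close> lies below \<open>N\<close>, the top coefficients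
      cancel; otherwise \<open>cond\<close> gives \<open>z k\<close> the prescribed sign.\<close>
    have "0 \<le> e * pcoeff (HZ k) N"
    proof (cases "tnorm (z k) < ereal N")
      case True
      then show ?thesis using pcoeff_eq_0_if_tnorm_less[of "HZ k" N] by (simp add: z)
    next
      case False
      then have "tnorm (z k) = ereal N" using z_le[OF m(1)] N by simp
      moreover have "z k \<in> T_sgn (b k)" using cond N False by simp
      ultimately have "sval (HZ k) = TElem (if b k then SPos else SNeg) N"
        by (auto simp: z T_sgn_def T_pos_def T_neg_def split: if_splits)
      then show ?thesis
        using sval_eq_pos_iff[of "HZ k" N] sval_eq_neg_iff[of "HZ k" N] by (auto simp: e_def split: if_splits)
    qed
    also have "e * pcoeff (HZ k) N = (\<Sum>i\<in>?G k. if i \<in> Bad k then - ((?d + 1) * c i) else c i)"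
      unfolding coeff[OF m(1) N] sum_distrib_left using tm by (rule sum.cong[OF refl])
    also have "\<dots> = (\<Sum>i\<in>?G k. c i - (if i \<in> Bad k then (?d + 2) * c i else 0))"
      by (rule sum.cong) (auto simp: algebra_simps)
    also have "\<dots> = sum c (?G k) - (?d + 2) * sum c (?G k \<inter> Bad k)"
      unfolding sum_subtractf sum.inter_restrict[OF finG] sum_distrib_left
      by (auto intro: sum.cong)
    finally have "(?d + 2) * sum c (?G k \<inter> Bad k) \<le> sum c (?G k)" by simp
    moreover have "0 < sum c (?G k)" using m(1) finG[of k] c GI by (intro sum_pos) auto
    ultimately show ?thesis by (simp add: divide_simps mult.commute)
  qed
  have "(\<Sum>k\<in>K. sum c (?G k \<inter> Bad k) / sum c (?G k)) < 1"
  proof -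
    have "K \<subseteq> range Some"
    proof
      fix k assume "k \<in> K"
      then show "k \<in> range Some" by (cases k) (auto simp: K_def)
    qed
    then have "card K \<le> card (range (Some :: 'd \<Rightarrow> _))" by (intro card_mono) auto
    then have K: "card K \<le> CARD('d)" by (simp add: card_image)
    have "(\<Sum>k\<in>K. sum c (?G k \<inter> Bad k) / sum c (?G k)) \<le> real (card K) * (1 / (?d + 2))"
      using ratio by (rule sum_bounded_above)
    also have "\<dots> < 1" using K by (simp add: field_simps)
    finally show ?thesis .
  qed
  moreover have "y i \<in> cone_of S" if "i \<in> I'" for i
    using x[of i] that I' unfolding cone_of_def y_def by blast
  ultimately obtain s where s: "s \<in> cone_of S"
    "\<And>k. \<exists>i\<in>?G k. s k = y i k \<and> (k \<in> K \<longrightarrow> i \<notin> Bad k)"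
    using greedy_composition[OF TC_cone_cone_of[OF S] fin ne, where y = y and c = c and K = K and Bad = Bad] c by blast
  have "beyond (b k) (z k) (s k)" for k
  proof (cases k)
    \<comment> \<open>The entries at \<open>None\<close> are the weights themselves. Their positive
      leading coefficients cannot cancel in the sum 1, so the top exponent is 0.\<close>
    case None
    obtain i where i: "i \<in> ?G k" "s k = y i k" using s(2) by blast
    have yN: "y j None = TElem SPos (lead_exp (l j))" for j by (simp add: y_def)
    define N where "N = lead_exp (l i)"
    have sN: "s k = TElem SPos N" using i(2) yN None by (simp add: N_def)
    have "pcoeff (l j * H j None) N = c j" if j: "j \<in> ?G None" for j
    proof -
      have "tnorm (y i None) = tnorm (y j None)"
        using i(1) j GI[of None] G_le[of i None j] G_le[of j None i] None by (meson antisym subsetD)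
      then have "N = lead_exp (l j)" by (simp add: yN N_def)
      then show ?thesis by (simp add: H_def c_def)
    qed
    then have "pcoeff 1 N = sum c (?G None)"
      using coeff[of i None N] i(1) None by (simp add: HZ_def yN N_def)
    also have "\<dots> > 0"
      using i(1) None finG c GI by (intro sum_pos) auto
    finally have "N = 0" by (simp add: pcoeff_one split: if_splits)
    then have "s k = z k" using sN None by (simp add: z_def one_symtrop_def)
    then show ?thesis using beyond_refl[of "z k"] by (simp add: z)
  next
    case (Some j)
    obtain i where i: "i \<in> ?G k" "s k = y i k" "k \<in> K \<longrightarrow> i \<notin> Bad k" using s(2) by blast
    have "s k \<in> T_sgn (b k)" if "s k \<noteq> 0" "tnorm (z k) < tnorm (s k) \<or> z k \<in> T_sgn (b k)"
    proof -
      have "k \<in> K" using that i(1,2) Some unfolding K_def by auto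
      then show ?thesis using i by (simp add: Bad_def)
    qed
    moreover have "s k \<in> T_signed" using i y GI[of k] by (metis subsetD sval_simps(3))
    ultimately show ?thesis using z_le[OF i(1)] i(2) by (auto simp: beyond_def admissible_def)
  qed
  then show ?thesis using s(1) unfolding z_def by blast
qed

lemma conv_TC_I: "(\<And>S. TC_convex S \<Longrightarrow> M \<subseteq> S \<Longrightarrow> z \<in> S) \<Longrightarrow> z \<in> conv_TC M"
  by (simp add: conv_TC_def hull_def)

lemma lifts_subset_conv_TC:
  fixes x :: "nat \<Rightarrow> symtrop ^ 'd"
  assumes "finite I"
  shows "(\<Inter>J. sval_vec ` (vec_convex hull ((\<lambda>i. lift_J J (x i)) ` I))) \<subseteq> conv_TC (x ` I)"
proof (intro subsetI conv_TC_I)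
  fix z S assume z: "z \<in> (\<Inter>J. sval_vec ` (vec_convex hull ((\<lambda>i. lift_J J (x i)) ` I)))"
    and S: "TC_convex S" "x ` I \<subseteq> S"
  have "\<exists>s\<in>cone_of S. \<forall>k. beyond (b k) (homog z k) (s k)" for b
  proof -
    obtain Z where Z: "Z \<in> vec_convex hull ((\<lambda>i. lift_J {j. \<not> b (Some j)} (x i)) ` I)" "z = sval_vec Z"
      using z by blast
    show ?thesis unfolding Z(2) by (rule ex_beyond_if_mem_lifted_hull[OF S(1) assms _ Z(1)]) (use S(2) in blast)
  qed
  moreover have "homog z k \<in> T_signed" for k
    using z by (cases k) (auto simp: sval_vec_def)
  ultimately have "homog z \<in> cone_of S"
    using mem_TC_cone_if_beyond[OF TC_cone_cone_of[OF S(1)], of "homog z"] by blast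
  then obtain r s where s: "s \<in> S" and eq: "homog z = (\<lambda>k. TElem SPos r * homog s k)"
    by (auto simp: cone_of_def)
  \<comment> \<open>Both homogenizations have the entry 1 at \<open>None\<close>.\<close>
  have "r = 0" using fun_cong[OF eq, of None] by (simp add: one_symtrop_def)
  then have "z $ i = s $ i" for i using fun_cong[OF eq, of "Some i"] by simp
  then have "z = s" by (simp add: vec_eq_iff)
  then show "z \<in> S" using s by simp
qed

section \<open>Functionals over the Puiseux field\<close>

text \<open>Let \<open>m i\<close> be the least of the chosen points \<open>p i j\<close> and take
  \<open>i\<close> with the largest \<open>m i\<close>. For every \<open>k\<close> it lies between
  \<open>m k\<close> and \<open>p i k\<close>, which both belong to \<open>A k\<close>. No
  completeness of the order enters.\<close>

lemma helly_linorder: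
  fixes A :: "'i \<Rightarrow> 'a::linorder set"
  assumes "finite I" "I \<noteq> {}"
    and conv: "\<And>i x y u. i \<in> I \<Longrightarrow> x \<in> A i \<Longrightarrow> y \<in> A i \<Longrightarrow> x \<le> u \<Longrightarrow> u \<le> y \<Longrightarrow> u \<in> A i"
    and meet: "\<And>i j. i \<in> I \<Longrightarrow> j \<in> I \<Longrightarrow> A i \<inter> A j \<noteq> {}"
  obtains u where "\<And>i. i \<in> I \<Longrightarrow> u \<in> A i"
proof -
  define p where "p i j = (SOME x. x \<in> A i \<inter> A j)" for i j
  have p: "p i j \<in> A i" "p i j \<in> A j" if "i \<in> I" "j \<in> I" for i j
    using someI_ex[of "\<lambda>x. x \<in> A i \<inter> A j"] meet[OF that] unfolding p_def by auto
  define m where "m i = Min (p i ` I)" for i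
  have m_in: "m i \<in> p i ` I" for i unfolding m_def using assms(1,2) by (intro Min_in) auto
  have m_le: "m i \<le> p i j" if "j \<in> I" for i j unfolding m_def using assms(1) that by simp
  have "Max (m ` I) \<in> m ` I" using assms(1,2) by (intro Max_in) auto
  then obtain i where i: "i \<in> I" "Max (m ` I) = m i" by auto
  have "m i \<in> A k" if k: "k \<in> I" for k
  proof (rule conv[OF k])
    show "m k \<in> A k" using m_in[of k] p k by auto
    show "m k \<le> m i" using i(2) k assms(1) by (metis Max_ge finite_imageI imageI)
    show "p i k \<in> A k" "m i \<le> p i k" using p(2)[OF i(1) k] m_le[OF k] .
  qed
  then show ?thesis by (rule that)
qed

lemma sval_uminus: "sval (- f) = TElem SNeg 0 * sval f"
proof -
  have "sval (- 1) = TElem SNeg 0"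
    by (simp add: sval_eq_neg_iff pcoeff_one tnorm_sval_le_iff)
  then show ?thesis using sval_mult[of "- 1" f] by simp
qed

text \<open>If \<open>h\<close> had smaller norm, the leading term of \<open>f\<close> would survive
  in \<open>f - h\<close> and make it positive.\<close>

lemma tnorm_sval_mono:
  assumes "0 < f" "f \<le> h"
  shows "tnorm (sval f) \<le> tnorm (sval h)"
proof (rule ccontr)
  assume less: "\<not> ?thesis"
  let ?r = "lead_exp f"
  have f: "sval f = TElem SPos ?r" using assms(1) by (simp add: sval_def)
  then have h0: "pcoeff h ?r = 0" "\<forall>b>?r. pcoeff h b = 0"
    using less pcoeff_eq_0_if_tnorm_less[of h ?r] tnorm_sval_le_iff[of h ?r] by (auto simp: not_le less_imp_le)
  have "0 < pcoeff (f - h) ?r" "tnorm (sval (f - h)) \<le> ereal ?r"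
    using f h0 tnorm_sval_le_iff[of f ?r] by (auto simp: sval_eq_pos_iff tnorm_sval_le_iff)
  then have "sval (f - h) = TElem SPos ?r" by (simp add: sval_eq_pos_iff)
  then have "0 < f - h" by (auto simp: sval_def split: if_splits)
  then show False using assms(2) by simp
qed

lemma sval_between_pos:
  assumes "0 < f" "f \<le> h" "h \<le> g" "sval f = sval g"
  shows "sval h = sval f"
proof -
  have pos: "0 < h" "0 < g" using assms by auto
  have "tnorm (sval h) = tnorm (sval f)"
    using tnorm_sval_mono[OF assms(1,2)] tnorm_sval_mono[OF pos(1) assms(3)] assms(4) by simp
  then show ?thesis using assms(1) pos by (simp add: sval_def)
qed

text \<open>Order convexity of the fibres of \<open>sval\<close> makes the parameter sets of a
  segment intervals. Negative values reduce to positive ones by reflection; if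
  \<open>f \<le> 0 \<le> g\<close>, equal valuations force both to vanish.\<close>

lemma sval_between:
  assumes "f \<le> h" "h \<le> g" "sval f = sval g"
  shows "sval h = sval f"
proof (cases "0 < f")
  case True
  then show ?thesis using sval_between_pos assms by blast
next
  case nf: False
  show ?thesis
  proof (cases "g < 0")
    case True
    have "sval (- h) = sval (- g)"
      using assms True by (intro sval_between_pos[of "- g" "- h" "- f"]) (simp_all add: sval_uminus)
    then have "sval (- (- h)) = sval (- (- g))" by (metis sval_uminus)
    then show ?thesis using assms(3) by simp
  next
    case False
    then have "f = 0 \<and> g = 0" using nf assms(3) by (auto simp: sval_def split: if_splits)
    then show ?thesis using assms by auto
  qed
qed

text \<open>Without a positive term of top norm, all coefficients at the top exponent would be
  nonpositive and one of them negative, so the sum would be negative.\<close>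

lemma dominant_pos_sval:
  assumes "finite I" "0 \<le> sum f I"
  shows "dominant_pos (\<lambda>i. sval (f i)) I"
proof (rule ccontr)
  assume nd: "\<not> ?thesis"
  then obtain i0 where i0: "i0 \<in> I" "sval (f i0) \<noteq> 0" by (auto simp: dominant_pos_def)
  define M where "M = Max ((\<lambda>i. tnorm (sval (f i))) ` I)"
  have "M \<in> (\<lambda>i. tnorm (sval (f i))) ` I" unfolding M_def using i0 assms(1) by (intro Max_in) auto
  then obtain m where m: "m \<in> I" "tnorm (sval (f m)) = M" by auto
  have le: "tnorm (sval (f i)) \<le> M" if "i \<in> I" for i unfolding M_def using assms(1) that by simp
  have "M \<noteq> -\<infinity>" using le[OF i0(1)] i0(2) by (metis ereal_infty_less_eq(2) tnorm_eq_minus_infinity)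
  then obtain N where N: "M = ereal N" using m(2) by (cases "sval (f m)") (auto simp: zero_symtrop_def)
  have neg: "sval (f i) = TElem SNeg N" if "i \<in> I" "tnorm (sval (f i)) = ereal N" for i
  proof -
    have "sval (f i) \<notin> T_pos" using nd le that N unfolding dominant_pos_def by metis
    moreover have "sval (f i) \<noteq> 0" using that(2) by auto
    ultimately show ?thesis using that(2) signed_iff[of "sval (f i)"] by (auto simp: T_neg_def)
  qed
  have nonpos: "pcoeff (f i) N \<le> 0" if "i \<in> I" for i
  proof (cases "tnorm (sval (f i)) = ereal N")
    case True
    then show ?thesis using neg[OF that] sval_eq_neg_iff[of "f i" N] by simp
  next
    case False
    then have "pcoeff (f i) N = 0" using le[OF that] N by (intro pcoeff_eq_0_if_tnorm_less) auto
    then show ?thesis by simp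
  qed
  have "pcoeff (f m) N < 0" using neg[OF m(1)] m(2) N sval_eq_neg_iff[of "f m" N] by simp
  then have "(\<Sum>i\<in>I. pcoeff (f i) N) < (\<Sum>i\<in>I. 0)" using assms(1) m(1) nonpos by (intro sum_strict_mono_ex1) auto
  then have "sval (sum f I) = TElem SNeg N"
    unfolding sval_eq_neg_iff using tnorm_sum_le[OF assms(1), of f "ereal N"] le N by simp
  then show False using assms(2) by (auto simp: sval_def split: if_splits)
qed

text \<open>The dominant positive term is made to win by rescaling the lifts by real
  constants.\<close>

lemma dominant_pos_lift:
  fixes A :: "'a::finite \<Rightarrow> puiseux"
  assumes dom: "dominant_pos (\<lambda>k. sval (A k) * z k) UNIV" and z: "\<And>k. z k \<in> T_signed" and one: "z k0 = 1"
  obtains Z where "\<And>k. sval (Z k) = z k" "Z k0 = 1" "0 \<le> (\<Sum>k\<in>UNIV. A k * Z k)"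
proof -
  have "\<exists>f. sval f = w \<and> (w = 1 \<longrightarrow> f = 1)" if "w \<in> T_signed" for w
  proof (cases "w = 1")
    case True
    then show ?thesis by (intro exI[of _ 1]) simp
  next
    case False
    from that consider "w = 0" | r where "w = TElem SPos r" | r where "w = TElem SNeg r"
      by (auto simp: signed_iff T_pos_def T_neg_def)
    then show ?thesis
    proof cases
      case 1
      then show ?thesis by (intro exI[of _ 0]) simp
    next
      case (2 r)
      then show ?thesis using False by (intro exI[of _ "pmonom 1 r"]) (simp add: sval_pmonom)
    next
      case (3 r)
      then show ?thesis using False by (intro exI[of _ "pmonom (- 1) r"]) (simp add: sval_pmonom)
    qed
  qed
  then obtain L where L: "\<And>w. w \<in> T_signed \<Longrightarrow> sval (L w) = w" "L 1 = 1"
    by (metis one_symtrop_mem(2))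
  have sc: "sval (pmonom r 0 * f) = sval f" if "r > 0" for r f
    using that by (simp add: sval_mult sval_pmonom)
  show ?thesis
  proof (cases "\<forall>k. sval (A k) * z k = 0")
    case True
    then have "A k * L (z k) = 0" for k using L(1)[OF z[of k]] by (metis sval_mult sval_simps(2))
    then have "(\<Sum>k\<in>UNIV. A k * L (z k)) = 0" by (intro sum.neutral) blast
    then show ?thesis using L z one by (intro that[of "\<lambda>k. L (z k)"]) simp_all
  next
    case False
    then obtain m where m: "sval (A m) * z m \<in> T_pos" "\<And>k. tnorm (sval (A k) * z k) \<le> tnorm (sval (A m) * z m)"
      using dom by (auto simp: dominant_pos_def)
    obtain N where N: "sval (A m) * z m = TElem SPos N" using m(1) by (auto simp: T_pos_def)
    define f where "f k = A k * L (z k)" for k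
    have sf: "sval (f k) = sval (A k) * z k" for k using L(1)[OF z] by (simp add: f_def sval_mult)
    define a where "a = pcoeff (f m) N"
    have a: "0 < a" using sval_eq_pos_iff[of "f m" N] sf N by (simp add: a_def)
    \<comment> \<open>Chosen so that \<open>R * a\<close> exceeds the absolute value of the
      remaining coefficient at exponent \<open>N\<close> by 1.\<close>
    define R where "R = (\<bar>\<Sum>k\<in>UNIV - {m}. pcoeff (f k) N\<bar> + 1) / a"
    have R: "0 < R" using a unfolding R_def by (intro divide_pos_pos) auto
    define W where "W k = (if k = m then pmonom R 0 else 1) * L (z k)" for k
    have sW: "sval (W k) = z k" for k using L(1)[OF z] R sc by (simp add: W_def)
    have pc: "pcoeff (pmonom c 0 * g) N = c * pcoeff g N" if "tnorm (sval g) \<le> ereal N" for c g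
      using pcoeff_times_top(1)[of 0 "pmonom c 0" N g] that by (auto simp: pmonom.rep_eq tnorm_sval_le_iff)
    have "(\<Sum>k\<in>UNIV. A k * W k) = pmonom R 0 * f m + (\<Sum>k\<in>UNIV - {m}. f k)"
    proof -
      have "(\<Sum>k\<in>UNIV - {m}. A k * W k) = (\<Sum>k\<in>UNIV - {m}. f k)"
        by (rule sum.cong) (auto simp: W_def f_def)
      then show ?thesis by (simp add: sum.remove[of UNIV m] W_def f_def mult.left_commute)
    qed
    moreover have "pcoeff (pmonom R 0 * f m + (\<Sum>k\<in>UNIV - {m}. f k)) N > 0"
    proof -
      have "pcoeff (pmonom R 0 * f m) N = R * a" using pc[of "f m" R] sf N by (simp add: a_def)
      also have "\<dots> = \<bar>\<Sum>k\<in>UNIV - {m}. pcoeff (f k) N\<bar> + 1" using a by (simp add: R_def)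
      finally show ?thesis by simp
    qed
    moreover have "tnorm (sval (\<Sum>k\<in>UNIV. A k * W k)) \<le> ereal N"
      using m(2) N by (intro tnorm_sum_le) (simp_all add: sval_mult sW)
    ultimately have "sval (\<Sum>k\<in>UNIV. A k * W k) = TElem SPos N" by (simp add: sval_eq_pos_iff)
    then have pos: "0 < (\<Sum>k\<in>UNIV. A k * W k)" by (auto simp: sval_def split: if_splits)
    \<comment> \<open>The rescaling may have hit the unit coordinate; dividing everything by the
      positive real \<open>q\<close> restores it and preserves valuations and signs.\<close>
    define q where "q = (if k0 = m then R else 1)"
    have q: "0 < q" using R by (simp add: q_def)
    have one': "1 = pmonom 1 0" by (rule puiseux_eqI) (simp add: pcoeff_one pmonom.rep_eq)
    have W0: "W k0 = pmonom q 0" using L(2) by (simp add: W_def one q_def one')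
    show ?thesis
    proof (rule that[of "\<lambda>k. pmonom (1 / q) 0 * W k"])
      show "sval (pmonom (1 / q) 0 * W k) = z k" for k using sc q sW by simp
      show "pmonom (1 / q) 0 * W k0 = 1" using q by (simp add: W0 pmonom_mult one')
      have "(\<Sum>k\<in>UNIV. A k * (pmonom (1 / q) 0 * W k)) = pmonom (1 / q) 0 * (\<Sum>k\<in>UNIV. A k * W k)"
        by (simp add: sum_distrib_left mult.left_commute)
      moreover have "0 < pmonom (1 / q) 0" using sval_pmonom[of "1 / q" 0] q by (auto simp: sval_def split: if_splits)
      ultimately show "0 \<le> (\<Sum>k\<in>UNIV. A k * (pmonom (1 / q) 0 * W k))" using pos by (simp add: less_imp_le)
    qed
  qed
qed

text \<open>The valuations of the coefficients define a closed halfspace containing both endpoints,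
  hence \<open>z\<close>; membership is then lifted back. The lift \<open>Z\<close> depends on the
  functional, so points for different functionals still have to be reconciled.\<close>

lemma conv_TC2_functional:
  fixes X Y A :: "puiseux ^ 'd"
  assumes z: "z \<in> conv_TC2 (sval_vec X) (sval_vec Y)" and A: "A \<noteq> 0"
    and X: "0 \<le> A0 + (\<Sum>k\<in>UNIV. A $ k * X $ k)" and Y: "0 \<le> A0 + (\<Sum>k\<in>UNIV. A $ k * Y $ k)"
  obtains Z where "sval_vec Z = z" "0 \<le> A0 + (\<Sum>k\<in>UNIV. A $ k * Z $ k)"
proof -
  define B where "B k = (case k of None \<Rightarrow> A0 | Some i \<Rightarrow> A $ i)" for k
  define H where "H V k = (case k of None \<Rightarrow> 1 | Some i \<Rightarrow> V $ i)" for V :: "puiseux ^ 'd" and k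
  have s: "case_option (sval A0) (($) (sval_vec A)) k = sval (B k)" for k
    by (cases k) (simp_all add: B_def sval_vec_def)
  have hs: "homog (sval_vec V) k = sval (H V k)" for V :: "puiseux ^ 'd" and k
    by (cases k) (simp_all add: H_def sval_vec_def)
  have sg: "sval A0 \<in> T_signed" "sval_vec V \<in> signed_vectors" for V :: "puiseux ^ 'd"
    by (simp_all add: signed_vectors_def sval_vec_def)
  let ?H = "closed_halfspace (sval A0) (sval_vec A)"
  note iff = closed_halfspace_iff[OF sg(1) sg(2)[of A]]
  have mem: "sval_vec V \<in> ?H" if "0 \<le> A0 + (\<Sum>k\<in>UNIV. A $ k * V $ k)" for V
  proof -
    have "0 \<le> (\<Sum>k\<in>UNIV. B k * H V k)" using that by (simp add: sum_option B_def H_def)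
    then have "dominant_pos (\<lambda>k. sval (B k * H V k)) UNIV" by (intro dominant_pos_sval) auto
    then show ?thesis by (simp add: iff sg s hs sval_mult)
  qed
  have "sval_vec A \<noteq> 0" using A by (auto simp: sval_vec_def vec_eq_iff)
  then have "?H \<in> closed_halfspaces" unfolding closed_halfspaces_def using sg by blast
  then have "z \<in> ?H" using z mem[OF X] mem[OF Y] unfolding conv_TC2_def by blast
  then have zs: "z \<in> signed_vectors" and dom: "dominant_pos (\<lambda>k. sval (B k) * homog z k) UNIV"
    by (simp_all add: iff s)
  obtain W where W: "\<And>k. sval (W k) = homog z k" "W None = 1" "0 \<le> (\<Sum>k\<in>UNIV. B k * W k)"
    using dominant_pos_lift[OF dom homog_signed[OF zs], of None] by auto
  show ?thesis
  proof (rule that[of "\<chi> i. W (Some i)"])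
    show "sval_vec (\<chi> i. W (Some i)) = z" by (simp add: sval_vec_def vec_eq_iff W(1))
    show "0 \<le> A0 + (\<Sum>k\<in>UNIV. A $ k * (\<chi> i. W (Some i)) $ k)" using W(2,3) by (simp add: sum_option B_def)
  qed
qed

section \<open>Images of convex sets\<close>

lemma zero_between:
  fixes p q :: "'a::linordered_field"
  assumes "0 \<le> p" "q \<le> 0"
  obtains t where "0 \<le> t" "t \<le> 1" "t * p + (1 - t) * q = 0"
proof (cases "p = q")
  case True
  then have "p = 0" "q = 0" using assms by auto
  then show ?thesis using that[of 0] by simp
next
  case False
  then have "0 < p - q" using assms by auto
  then show ?thesis using assms by (intro that[of "- q / (p - q)"]) (auto simp: field_simps)
qed

lemma convex_combination_between:
  fixes t p q :: "'a::linordered_field"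
  assumes "0 \<le> t" "t \<le> 1"
  shows "min p q \<le> t * p + (1 - t) * q" "t * p + (1 - t) * q \<le> max p q"
proof -
  have "t * min p q + (1 - t) * min p q \<le> t * p + (1 - t) * q"
    using assms by (intro add_mono mult_left_mono) auto
  then show "min p q \<le> t * p + (1 - t) * q" by (simp add: algebra_simps)
  have "t * p + (1 - t) * q \<le> t * max p q + (1 - t) * max p q"
    using assms by (intro add_mono mult_left_mono) auto
  then show "t * p + (1 - t) * q \<le> max p q" by (simp add: algebra_simps)
qed

lemma sval_convex_combination:
  assumes "0 \<le> t" "t \<le> 1" "sval p = s" "sval q = s"
  shows "sval (t * p + (1 - t) * q) = s"
  using sval_between[OF convex_combination_between[OF assms(1,2), of p q]] assms(3,4)
  by (auto simp: min_def max_def split: if_splits)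

text \<open>The functionals bounding coordinate \<open>k\<close> below by the minimum and above by
  the maximum of its end values yield two lifts of \<open>z $ k\<close>. Either one of them lies in
  the interval, or they enclose it and \<open>sval_between\<close> makes the minimum a lift.\<close>

lemma conv_TC2_coordinate:
  fixes X Y :: "puiseux ^ 'd"
  assumes z: "z \<in> conv_TC2 (sval_vec X) (sval_vec Y)"
  obtains u where "0 \<le> u" "u \<le> 1" "sval (u * X $ k + (1 - u) * Y $ k) = z $ k"
proof -
  have ax: "(\<Sum>i\<in>UNIV. axis k c $ i * V $ i) = c * V $ k" for c and V :: "puiseux ^ 'd"
  proof -
    have "(\<Sum>i\<in>UNIV. axis k c $ i * V $ i) = (\<Sum>i\<in>UNIV. if i = k then c * V $ i else 0)"
      by (rule sum.cong) (auto simp: axis_def)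
    then show ?thesis by simp
  qed
  have ne: "axis k c \<noteq> 0" if "c \<noteq> 0" for c :: puiseux using that by (simp add: axis_eq_0_iff)
  let ?m = "min (X $ k) (Y $ k)" and ?M = "max (X $ k) (Y $ k)"
  obtain P where P: "sval_vec P = z" "0 \<le> - ?m + (\<Sum>i\<in>UNIV. axis k 1 $ i * P $ i)"
    by (rule conv_TC2_functional[OF z ne[of 1], of "- ?m"]) (auto simp: ax)
  obtain P' where P': "sval_vec P' = z" "0 \<le> ?M + (\<Sum>i\<in>UNIV. axis k (- 1) $ i * P' $ i)"
    by (rule conv_TC2_functional[OF z ne[of "- 1"], of ?M]) (auto simp: ax)
  have "sval (P $ k) = z $ k" "sval (P' $ k) = z $ k"
    using P(1) P'(1) by (metis sval_vec_nth)+
  moreover have "?m \<le> P $ k" "P' $ k \<le> ?M" using P(2) P'(2) unfolding ax by simp_all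
  ultimately have p: "?m \<le> P $ k" "P' $ k \<le> ?M" "sval (P $ k) = z $ k" "sval (P' $ k) = z $ k"
    by blast+
  obtain w where w: "?m \<le> w" "w \<le> ?M" "sval w = z $ k"
  proof (cases "P $ k \<le> ?M \<or> ?m \<le> P' $ k")
    case True
    then show ?thesis using that p by blast
  next
    case False
    then have "sval ?m = z $ k" using p sval_between[of "P' $ k" ?m "P $ k"] by (auto simp: not_le less_imp_le)
    then show ?thesis using that[of ?m] by simp
  qed
  show ?thesis
  proof (cases "X $ k \<le> Y $ k")
    case True
    obtain t where "0 \<le> t" "t \<le> 1" "t * (Y $ k - w) + (1 - t) * (X $ k - w) = 0"
      using zero_between[of "Y $ k - w" "X $ k - w"] w True by auto
    moreover from this(3) have "(1 - t) * X $ k + (1 - (1 - t)) * Y $ k = w" by (simp add: algebra_simps)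
    ultimately show ?thesis using w(3) by (intro that[of "1 - t"]) simp_all
  next
    case False
    obtain t where "0 \<le> t" "t \<le> 1" "t * (X $ k - w) + (1 - t) * (Y $ k - w) = 0"
      using zero_between[of "X $ k - w" "Y $ k - w"] w False by auto
    moreover from this(3) have "t * X $ k + (1 - t) * Y $ k = w" by (simp add: algebra_simps)
    ultimately show ?thesis using w(3) by (intro that[of t]) simp_all
  qed
qed

text \<open>The affine form \<open>n\<close> vanishes on the line through the projections of
  \<open>X\<close> and \<open>Y\<close>. Used with both signs, it gives lifts of \<open>z\<close> on
  both sides of that line, and a convex combination on the line keeps the valuations. The parameter
  may leave the unit interval.\<close>

lemma conv_TC2_coordinate_pair:
  fixes X Y :: "puiseux ^ 'd"
  assumes z: "z \<in> conv_TC2 (sval_vec X) (sval_vec Y)" 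
  obtains u where "sval (u * X $ j + (1 - u) * Y $ j) = z $ j" "sval (u * X $ k + (1 - u) * Y $ k) = z $ k"
proof -
  define b where "b i = X $ i - Y $ i" for i
  have const: "u * X $ i + (1 - u) * Y $ i = Y $ i + u * b i" for u i
    by (simp add: b_def algebra_simps)
  show ?thesis
  proof (cases "j = k \<or> b j = 0 \<or> b k = 0")
    case True
    obtain u where u: "sval (u * X $ j + (1 - u) * Y $ j) = z $ j" using conv_TC2_coordinate[OF z] by metis
    obtain v where v: "sval (v * X $ k + (1 - v) * Y $ k) = z $ k" using conv_TC2_coordinate[OF z] by metis
    show ?thesis
    \<comment> \<open>A coordinate where \<open>X\<close> and \<open>Y\<close> agree does not depend
      on the parameter, so the one found for the other coordinate serves for both.\<close>
    proof (cases "b j = 0")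
      case True
      then show ?thesis using u v by (intro that[of v]) (simp_all add: const)
    next
      case False
      then have "j = k \<or> b k = 0" using \<open>j = k \<or> b j = 0 \<or> b k = 0\<close> by blast
      then show ?thesis using u v by (intro that[of u]) (auto simp: const)
    qed
  next
    case False
    then have jk: "j \<noteq> k" and b: "b j \<noteq> 0" "b k \<noteq> 0" by auto
    define A where "A e = (\<chi> i. if i = j then e * b k else if i = k then - (e * b j) else 0)" for e
    have sum: "(\<Sum>i\<in>UNIV. A e $ i * V $ i) = e * (b k * V $ j - b j * V $ k)" for e and V :: "puiseux ^ 'd"
    proof -
      have "(\<Sum>i\<in>UNIV. A e $ i * V $ i) =
          (\<Sum>i\<in>UNIV. (if i = j then e * b k * V $ i else 0) + (if i = k then - (e * b j) * V $ i else 0))"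
        by (rule sum.cong) (use jk in \<open>auto simp: A_def\<close>)
      also have "\<dots> = e * b k * V $ j + - (e * b j) * V $ k" by (simp only: sum.distrib) simp
      finally show ?thesis by (simp add: algebra_simps)
    qed
    define n where "n V = b k * (V $ j - Y $ j) - b j * (V $ k - Y $ k)" for V :: "puiseux ^ 'd"
    have n_eq: "- (e * (b k * Y $ j - b j * Y $ k)) + (\<Sum>i\<in>UNIV. A e $ i * V $ i) = e * n V" for e V
      unfolding sum n_def by (simp add: algebra_simps)
    have n0: "n X = 0" "n Y = 0" by (simp_all add: n_def b_def mult.commute)
    have "\<exists>P. sval_vec P = z \<and> 0 \<le> e * n P" if "e \<noteq> 0" for e
    proof -
      have "A e $ j \<noteq> 0" using b that by (simp add: A_def)
      then have "A e \<noteq> 0" by (metis zero_index)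
      then show ?thesis
        using conv_TC2_functional[OF z, of "A e" "- (e * (b k * Y $ j - b j * Y $ k))"]
        unfolding n_eq n0 by auto
    qed
    from this[of 1] this[of "- 1"] obtain P P' where P: "sval_vec P = z" "0 \<le> n P"
      and P': "sval_vec P' = z" "n P' \<le> 0" by auto
    obtain t where t: "0 \<le> t" "t \<le> 1" "t * n P + (1 - t) * n P' = 0" using zero_between[OF P(2) P'(2)] .
    define W where "W i = t * P $ i + (1 - t) * P' $ i" for i
    have W: "sval (W i) = z $ i" for i
    proof -
      have "sval (P $ i) = z $ i" "sval (P' $ i) = z $ i"
        using P(1) P'(1) by (metis sval_vec_nth)+
      then show ?thesis unfolding W_def using t by (intro sval_convex_combination)
    qed
    have "b k * (W j - Y $ j) - b j * (W k - Y $ k) = t * n P + (1 - t) * n P'"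
      by (simp add: n_def W_def algebra_simps)
    then have "b k * (W j - Y $ j) = b j * (W k - Y $ k)" using t(3) by simp
    \<comment> \<open>The parameter of the point on the line is read off at coordinate
      \<open>j\<close>.\<close>
    then have "Y $ k + (W j - Y $ j) / b j * b k = W k" "Y $ j + (W j - Y $ j) / b j * b j = W j"
      using b by (simp_all add: field_simps)
    then show ?thesis
      using W by (intro that[of "(W j - Y $ j) / b j"]) (simp_all only: const)
  qed
qed

text \<open>Every coordinate confines the parameter to an order-convex set, and \<open>None\<close>
  adds the unit interval. The two preceding lemmas give pairwise intersections, and Helly's theorem
  a common parameter.\<close>

lemma conv_TC2_subset_segment:
  fixes X Y :: "puiseux ^ 'd"
  assumes z: "z \<in> conv_TC2 (sval_vec X) (sval_vec Y)"
  obtains u where "0 \<le> u" "u \<le> 1" "sval_vec (u *s X + (1 - u) *s Y) = z"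
proof -
  define g where "g i u = u * X $ i + (1 - u) * Y $ i" for i u
  define A where "A k = (case k of None \<Rightarrow> {0..1} | Some i \<Rightarrow> {u. sval (g i u) = z $ i})" for k
  obtain u where "\<And>k. k \<in> UNIV \<Longrightarrow> u \<in> A k"
  proof (rule helly_linorder[of UNIV A])
    fix k x y u assume A: "x \<in> A k" "y \<in> A k" and u: "x \<le> u" "u \<le> y"
    show "u \<in> A k"
    proof (cases k)
      case None
      then show ?thesis using A u by (auto simp: A_def)
    next
      case (Some i)
      have g: "g i u = Y $ i + u * (X $ i - Y $ i)" for u by (simp add: g_def algebra_simps)
      have eq: "sval (g i x) = z $ i" "sval (g i y) = z $ i" using A Some by (auto simp: A_def)
      have "sval (g i u) = z $ i"
      proof (cases "0 \<le> X $ i - Y $ i")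
        case True
        then have "g i x \<le> g i u" "g i u \<le> g i y" unfolding g using u by (auto intro: mult_right_mono)
        then show ?thesis using sval_between eq by metis
      next
        case False
        then have "g i y \<le> g i u" "g i u \<le> g i x" unfolding g using u by (auto intro: mult_right_mono_neg)
        then show ?thesis using sval_between eq by metis
      qed
      then show ?thesis using Some by (simp add: A_def)
    qed
  next
    fix j k :: "'d option"
    have coord: "A None \<inter> A (Some i) \<noteq> {}" for i
    proof -
      obtain u where "0 \<le> u" "u \<le> 1" "sval (g i u) = z $ i"
        unfolding g_def using conv_TC2_coordinate[OF z] .
      then have "u \<in> A None \<inter> A (Some i)" by (simp add: A_def)
      then show ?thesis by blast
    qed
    have pair: "A (Some i) \<inter> A (Some l) \<noteq> {}" for i l
    proof -
      obtain u where "sval (g i u) = z $ i" "sval (g l u) = z $ l"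
        unfolding g_def using conv_TC2_coordinate_pair[OF z] .
      then have "u \<in> A (Some i) \<inter> A (Some l)" by (simp add: A_def)
      then show ?thesis by blast
    qed
    have "0 \<in> A None" by (simp add: A_def)
    then show "A j \<inter> A k \<noteq> {}"
      using coord pair by (cases j; cases k) (auto simp: Int_commute)
  qed auto
  then have A: "u \<in> A k" for k by simp
  have "0 \<le> u" "u \<le> 1" using A[of None] by (simp_all add: A_def)
  moreover have "sval_vec (u *s X + (1 - u) *s Y) = z"
    using A[of "Some i" for i] by (simp add: A_def g_def sval_vec_def vec_eq_iff)
  ultimately show ?thesis by (rule that)
qed

lemma TC_convex_sval_image:
  assumes "vec_convex V"
  shows "TC_convex (sval_vec ` V)"
  unfolding TC_convex_def
proof (intro conjI ballI subsetI)
  fix x assume "x \<in> sval_vec ` V"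
  then show "x \<in> signed_vectors" by (auto simp: signed_vectors_def sval_vec_def)
next
  fix x y z assume "x \<in> sval_vec ` V" "y \<in> sval_vec ` V" and z: "z \<in> conv_TC2 x y"
  then obtain X Y where XY: "X \<in> V" "Y \<in> V" "x = sval_vec X" "y = sval_vec Y" by auto
  obtain u where u: "0 \<le> u" "u \<le> 1" "sval_vec (u *s X + (1 - u) *s Y) = z"
    using conv_TC2_subset_segment z XY by metis
  have "u *s X + (1 - u) *s Y \<in> V" using assms XY u unfolding vec_convex_def by simp
  then show "z \<in> sval_vec ` V" using u(3) by blast
qed

section \<open>The cycle of inclusions between the three sets\<close>

lemma conv_TC_subset_sval_hull:
  assumes "\<And>i. i \<in> I \<Longrightarrow> sval_vec (X i) = x i"
  shows "conv_TC (x ` I) \<subseteq> sval_vec ` (vec_convex hull (X ` I))"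
  unfolding conv_TC_def
proof (rule hull_minimal)
  show "x ` I \<subseteq> sval_vec ` (vec_convex hull (X ` I))"
  proof
    fix y assume "y \<in> x ` I"
    then obtain i where "i \<in> I" "y = x i" by blast
    then have "y = sval_vec (X i)" "X i \<in> vec_convex hull (X ` I)"
      using assms[of i] by (auto intro: hull_inc)
    then show "y \<in> sval_vec ` (vec_convex hull (X ` I))" by (rule image_eqI)
  qed
qed (rule TC_convex_sval_image[OF vec_convex_hull])

theorem corollary6p4:
  fixes x :: "nat \<Rightarrow> symtrop ^ 'd" and n :: nat
  assumes "n \<ge> 1"
    and "\<And>i. i \<in> {1..n} \<Longrightarrow> x i \<in> signed_vectors"
  shows "conv_TC (x ` {1..n}) =
           \<Inter>{sval_vec ` (vec_convex hull (X ` {1..n})) | X :: nat \<Rightarrow> puiseux ^ 'd.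
               \<forall>i\<in>{1..n}. sval_vec (X i) = x i}
       \<and> \<Inter>{sval_vec ` (vec_convex hull (X ` {1..n})) | X :: nat \<Rightarrow> puiseux ^ 'd.
               \<forall>i\<in>{1..n}. sval_vec (X i) = x i} =
           (\<Inter>J :: 'd set. sval_vec ` (vec_convex hull ((\<lambda>i. lift_J J (x i)) ` {1..n})))"
    (is "?C = ?all \<and> ?all = ?J")
proof -
  have "?C \<subseteq> ?all"
  proof (rule Inter_greatest)
    fix W assume "W \<in> {sval_vec ` (vec_convex hull (X ` {1..n})) | X :: nat \<Rightarrow> puiseux ^ 'd.
      \<forall>i\<in>{1..n}. sval_vec (X i) = x i}"
    then obtain X :: "nat \<Rightarrow> puiseux ^ 'd" where
      X: "W = sval_vec ` (vec_convex hull (X ` {1..n}))" "\<forall>i\<in>{1..n}. sval_vec (X i) = x i" by auto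
    show "?C \<subseteq> W" unfolding X(1) by (rule conv_TC_subset_sval_hull) (use X(2) in blast)
  qed
  \<comment> \<open>The lifts \<open>lift_J J (x i)\<close> are one of the families of preimages, by
    \<open>sval_vec_lift_J\<close>.\<close>
  moreover have "?all \<subseteq> ?J"
  proof (intro INT_greatest)
    fix J
    show "?all \<subseteq> sval_vec ` (vec_convex hull ((\<lambda>i. lift_J J (x i)) ` {1..n}))"
      by (intro Inter_lower CollectI exI[of _ "\<lambda>i. lift_J J (x i)"] conjI refl ballI
          sval_vec_lift_J assms(2))
  qed
  moreover have "?J \<subseteq> ?C" by (rule lifts_subset_conv_TC) simp
  ultimately show ?thesis by (meson conjI order.trans subset_antisym)
qed

end
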